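(* Let $(M,d,\mu)$ be an ultra-metric measure space and let $(\mathcal{E},\mathcal{F})$ be the jump-type Dirichlet form described in the context. Fix $\alpha>0$, $\beta>0$ and $R_0\in(0,\operatorname{diam}M]$ (the case $R_0=\operatorname{diam}M=\infty$ is allowed). If conditions $(TJ)$ and $(DUE)$ hold, then condition $(wUE)$ holds: the heat kernel $p_t$ of $(\mathcal{E},\mathcal{F})$ exists and there is a constant $C>0$ such that $$p_t(x,y)\le \frac{C}{t^{\alpha/\beta}}\left(1+\frac{d(x,y)\wedge R_0}{t^{1/\beta}}\right)^{-\beta}$$ for all $t\in(0,R_0^\beta)$ and $\mu$-almost all $x,y\in M$.
   Context: $(M,d,\mu)$ is an ultra-metric measure space: $M$ is locally compact and separable, $d$ is an ultra-metric, i.e. $d(x,y)\le\max\{d(x,z),d(z,y)\}$ for all $x,y,z\in M$, and $\mu$ is a Radon measure on $M$ with full support. Balls are $B(x,r)=\{y\in M: d(x,y)\le r\}$. Let $j$ be a symmetric Radon measure on $(M\times M)\setminus\mathrm{diag}$ with $j(B,B^c)<\infty$ for every ball $B$. Define $\mathcal{E}(f,g)=\iint_{M\times M\setminus \mathrm{diag}}(f(x)-f(y))(g(x)-g(y))\,dj(x,y)$, $\mathcal{E}(f)=\mathcal{E}(f,f)$; let $\mathcal{D}$ be the set of finite linear combinations $\sum_i c_i\mathbf 1_{B_i}$ with $c_i\in\mathbb R$ and $B_i$ pairwise disjoint compact balls, and let $\mathcal F$ be the closure of $\mathcal D$ in the norm $\sqrt{\mathcal E(u)+\|u\|_2^2}$.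 Then $(\mathcal E,\mathcal F)$ is a regular Dirichlet form on $L^2(M,\mu)$; $p_t(x,y)$ denotes its heat kernel (integral kernel of its heat semigroup $P_t$ w.r.t. $\mu$). $C$ denotes positive constants. Condition $(TJ)$: there is a transition kernel $J(x,dy)$ with $dj(x,y)=J(x,dy)\,d\mu(x)$ and a constant $C$ such that $J(x,B(x,r)^c)\le C r^{-\beta}$ for all $x\in M$ and $r\in(0,R_0)$. Condition $(DUE)$: the heat kernel $p_t(x,y)$ exists and $p_t(x,y)\le C t^{-\alpha/\beta}$ for all $t\in(0,R_0^\beta)$ and $\mu$-almost all $x,y\in M$. *)

theory Defs
  imports "HOL-Analysis.Analysis"
begin

text \<open>The space M is the whole type 'a, with d = dist. Balls are closed balls cball x r, r > 0.\<close>

definition ultrametric_space :: "'a::metric_space itself \<Rightarrow> bool" where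
  "ultrametric_space _ \<longleftrightarrow>
     (\<forall>x y z::'a. dist x y \<le> max (dist x z) (dist z y)) \<and> locally compact (UNIV::'a set)"

definition radon_full_support :: "'a::metric_space measure \<Rightarrow> bool" where
  "radon_full_support \<mu> \<longleftrightarrow>
     sets \<mu> = sets borel \<and>
     (\<forall>K. compact K \<longrightarrow> emeasure \<mu> K < \<infinity>) \<and>
     (\<forall>U. open U \<and> U \<noteq> {} \<longrightarrow> emeasure \<mu> U > 0)"

definition is_ball :: "'a::metric_space set \<Rightarrow> bool" where
  "is_ball B \<longleftrightarrow> (\<exists>x r. 0 < r \<and> B = cball x r)"

definition diagonal :: "('a \<times> 'a) set" where
  "diagonal = {z. fst z = snd z}"

text \<open>j: symmetric Radon measure on (M x M) minus the diagonal (represented as a Borel measure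
  on M x M not charging the diagonal), with j(B, B^c) finite for every ball B.\<close>
definition jump_measure :: "('a::metric_space \<times> 'a) measure \<Rightarrow> bool" where
  "jump_measure j \<longleftrightarrow>
     sets j = sets (borel :: ('a \<times> 'a) measure) \<and>
     emeasure j diagonal = 0 \<and>
     (\<forall>A\<in>sets j. emeasure j ((\<lambda>(x,y). (y,x)) ` A) = emeasure j A) \<and>
     (\<forall>K. compact K \<and> K \<inter> diagonal = {} \<longrightarrow> emeasure j K < \<infinity>) \<and>
     (\<forall>B. is_ball B \<longrightarrow> emeasure j (B \<times> (- B)) < \<infinity>)"

definition L2 :: "'a measure \<Rightarrow> ('a \<Rightarrow> real) set" where
  "L2 \<mu> = {f. f \<in> borel_measurable \<mu> \<and> integrable \<mu> (\<lambda>x. (f x)\<^sup>2)}"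

definition jump_energy :: "('a \<times> 'a) measure \<Rightarrow> ('a \<Rightarrow> real) \<Rightarrow> ennreal" where
  "jump_energy j f = (\<integral>\<^sup>+ z. ennreal ((f (fst z) - f (snd z))\<^sup>2) \<partial>j)"

definition simple_ball_functions :: "('a::metric_space \<Rightarrow> real) set" where
  "simple_ball_functions =
     {f. \<exists>(I::nat set) c B. finite I \<and> (\<forall>i\<in>I. is_ball (B i) \<and> compact (B i)) \<and>
          disjoint_family_on B I \<and> f = (\<lambda>x. \<Sum>i\<in>I. c i * indicator (B i) x)}"

definition form_domain :: "'a::metric_space measure \<Rightarrow> ('a \<times> 'a) measure \<Rightarrow> ('a \<Rightarrow> real) set" where
  "form_domain \<mu> j =
     {f \<in> L2 \<mu>. \<exists>u. (\<forall>n. u n \<in> simple_ball_functions) \<and>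
        (\<lambda>n. (\<integral>\<^sup>+ x. ennreal ((u n x - f x)\<^sup>2) \<partial>\<mu>)) \<longlonglongrightarrow> 0 \<and>
        (\<lambda>n. jump_energy j (\<lambda>x. u n x - f x)) \<longlonglongrightarrow> 0}"

definition ext_form :: "'a::metric_space measure \<Rightarrow> ('a \<times> 'a) measure \<Rightarrow> ('a \<Rightarrow> real) \<Rightarrow> ennreal" where
  "ext_form \<mu> j f = (if f \<in> form_domain \<mu> j then jump_energy j f else \<infinity>)"

text \<open>P is the heat semigroup of (E,F): the strongly continuous symmetric contraction
  semigroup on L^2 whose associated form is (E,F), i.e. for every f in L^2,
  (1/t)(f - P_t f, f) tends to E(f) as t -> 0+, with E(f) = infinity for f not in F.
  (This determines the semigroup uniquely.)\<close>
definition heat_semigroup ::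
  "'a::metric_space measure \<Rightarrow> ('a \<times> 'a) measure \<Rightarrow> (real \<Rightarrow> ('a \<Rightarrow> real) \<Rightarrow> ('a \<Rightarrow> real)) \<Rightarrow> bool" where
  "heat_semigroup \<mu> j P \<longleftrightarrow>
     (\<forall>t>0. \<forall>f\<in>L2 \<mu>. P t f \<in> L2 \<mu>) \<and>
     (\<forall>t>0. \<forall>f\<in>L2 \<mu>. \<forall>g\<in>L2 \<mu>. \<forall>a::real.
        AE x in \<mu>. P t (\<lambda>y. a * f y + g y) x = a * P t f x + P t g x) \<and>
     (\<forall>t>0. \<forall>f\<in>L2 \<mu>. \<forall>g\<in>L2 \<mu>. (AE x in \<mu>. f x = g x) \<longrightarrow> (AE x in \<mu>. P t f x = P t g x)) \<and>
     (\<forall>t>0. \<forall>f\<in>L2 \<mu>. \<forall>g\<in>L2 \<mu>.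
        (\<integral>x. P t f x * g x \<partial>\<mu>) = (\<integral>x. f x * P t g x \<partial>\<mu>)) \<and>
     (\<forall>t>0. \<forall>f\<in>L2 \<mu>. (\<integral>x. (P t f x)\<^sup>2 \<partial>\<mu>) \<le> (\<integral>x. (f x)\<^sup>2 \<partial>\<mu>)) \<and>
     (\<forall>s>0. \<forall>t>0. \<forall>f\<in>L2 \<mu>. AE x in \<mu>. P (s + t) f x = P s (P t f) x) \<and>
     (\<forall>f\<in>L2 \<mu>. ((\<lambda>t. \<integral>x. (P t f x - f x)\<^sup>2 \<partial>\<mu>) \<longlongrightarrow> 0) (at_right 0)) \<and>
     (\<forall>f\<in>L2 \<mu>. ((\<lambda>t. ennreal ((1 / t) * (\<integral>x. (f x - P t f x) * f x \<partial>\<mu>)))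
                     \<longlongrightarrow> ext_form \<mu> j f) (at_right 0))"

definition heat_kernel ::
  "'a::metric_space measure \<Rightarrow> ('a \<times> 'a) measure \<Rightarrow> (real \<Rightarrow> 'a \<Rightarrow> 'a \<Rightarrow> real) \<Rightarrow> bool" where
  "heat_kernel \<mu> j p \<longleftrightarrow>
     (\<exists>P. heat_semigroup \<mu> j P \<and>
        (\<forall>t>0. (\<lambda>z. p t (fst z) (snd z)) \<in> borel_measurable (\<mu> \<Otimes>\<^sub>M \<mu>) \<and>
           (\<forall>f\<in>L2 \<mu>. AE x in \<mu>. integrable \<mu> (\<lambda>y. p t x y * f y) \<and>
                                 P t f x = (\<integral>y. p t x y * f y \<partial>\<mu>))))"

definition jump_kernel :: "'a::metric_space measure \<Rightarrow> ('a \<times> 'a) measure \<Rightarrow> ('a \<Rightarrow> 'a measure) \<Rightarrow> bool" where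
  "jump_kernel \<mu> j J \<longleftrightarrow>
     (\<forall>x. sets (J x) = sets borel) \<and>
     (\<forall>A\<in>sets borel. (\<lambda>x. emeasure (J x) A) \<in> borel_measurable \<mu>) \<and>
     (\<forall>A\<in>sets j. emeasure j A = (\<integral>\<^sup>+ x. emeasure (J x) (Pair x -` A) \<partial>\<mu>))"

definition diam_M :: "'a::metric_space itself \<Rightarrow> ereal" where
  "diam_M _ = (SUP x\<in>(UNIV::'a set). SUP y\<in>(UNIV::'a set). ereal (dist x y))"

definition ereal_powr :: "ereal \<Rightarrow> real \<Rightarrow> ereal" where
  "ereal_powr R b = (case R of ereal r \<Rightarrow> ereal (r powr b) | PInfty \<Rightarrow> PInfty | MInfty \<Rightarrow> 0)"

definition dist_min :: "ereal \<Rightarrow> 'a::metric_space \<Rightarrow> 'a \<Rightarrow> real" where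
  "dist_min R0 x y = real_of_ereal (min (ereal (dist x y)) R0)"

definition cond_TJ :: "'a::metric_space measure \<Rightarrow> ('a \<times> 'a) measure \<Rightarrow> real \<Rightarrow> ereal \<Rightarrow> bool" where
  "cond_TJ \<mu> j \<beta> R0 \<longleftrightarrow>
     (\<exists>J C. jump_kernel \<mu> j J \<and>
        (\<forall>x r. 0 < r \<and> ereal r < R0 \<longrightarrow> emeasure (J x) (- cball x r) \<le> ennreal (C * r powr (- \<beta>))))"

definition cond_DUE :: "'a::metric_space measure \<Rightarrow> ('a \<times> 'a) measure \<Rightarrow> real \<Rightarrow> real \<Rightarrow> ereal \<Rightarrow> bool" where
  "cond_DUE \<mu> j \<alpha> \<beta> R0 \<longleftrightarrow>
     (\<exists>p. heat_kernel \<mu> j p \<and> (\<exists>C>0. \<forall>t. 0 < t \<and> ereal t < ereal_powr R0 \<beta> \<longrightarrow>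
        (AE z in \<mu> \<Otimes>\<^sub>M \<mu>. p t (fst z) (snd z) \<le> C * t powr (- \<alpha> / \<beta>))))"

definition cond_wUE :: "'a::metric_space measure \<Rightarrow> ('a \<times> 'a) measure \<Rightarrow> real \<Rightarrow> real \<Rightarrow> ereal \<Rightarrow> bool" where
  "cond_wUE \<mu> j \<alpha> \<beta> R0 \<longleftrightarrow>
     (\<exists>p. heat_kernel \<mu> j p \<and> (\<exists>C>0. \<forall>t. 0 < t \<and> ereal t < ereal_powr R0 \<beta> \<longrightarrow>
        (AE z in \<mu> \<Otimes>\<^sub>M \<mu>. p t (fst z) (snd z) \<le>
           C / t powr (\<alpha> / \<beta>) * (1 + dist_min R0 (fst z) (snd z) / t powr (1 / \<beta>)) powr (- \<beta>))))"

end

theory Submission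
  imports Defs
begin

text \<open>
  The semigroup property reduces the off-diagonal estimate to a bound on escape from balls. If
  \<open>d(x,y) > r\<close>, then the balls \<open>B(x,r)\<close> and \<open>B(y,r)\<close> are disjoint, so in
  \<open>p\<^sub>t(x,y) = \<integral> p\<^sub>t\<^sub>/\<^sub>2(x,z) p\<^sub>t\<^sub>/\<^sub>2(z,y) dz\<close> every \<open>z\<close> lies outside one of them. There one factor
  is bounded by (DUE), and the other one integrates to at most \<open>C t r\<^sup>-\<^sup>\<beta>\<close>.

  The escape bound says that \<open>P\<^sub>t f \<le> 2 \<Lambda> t\<close> on a ball \<open>B\<close> whenever \<open>f \<le> 1\<close> vanishes on \<open>B\<close>, where
  \<open>\<Lambda> = C r\<^sup>-\<^sup>\<beta>\<close> bounds the rate of jumps out of \<open>B\<close> (in an ultrametric space a ball of radius \<open>r\<close> is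
  centred at each of its points, so (TJ) gives this rate at once). It is a comparison principle: the
  squared \<open>L\<^sup>2\<close> norm of \<open>1\<^sub>B (P\<^sub>t f - 2 \<Lambda> t)\<^sup>+\<close> has nonpositive right derivative. The indicator of a
  non-compact ball need not be in the form domain, but multiplying by it preserves the domain, which is
  all that this argument uses. The same principle on the whole space yields positivity and the
  sub-Markov property of the semigroup.
\<close>

section \<open>Square-integrable functions\<close>

text \<open>The semigroup is specified only through the limit of (f - P_t f, f) / t, not through a
  generator. The derivative of the excess is therefore estimated with the finite difference forms
  \<open>En h\<close>: the linear term of one time step is a multiple of \<open>En h\<close>, and
  the quadratic remainder is o(h) at functions of finite energy, which \<open>P t f\<close> is for
  every t > 0. A one-sided Dini estimate and the absence of upward jumps replace differentiability.

  On a space of infinite measure the level 2 \<Lambda> t is not square integrable. Every term that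
  contains it is therefore confined to the set where \<open>P t f\<close> exceeds it, where
  Chebyshev's inequality applies. The slope is 2 \<Lambda> because the energy integrates over
  ordered pairs, so that each jump across the boundary of the ball is counted twice.

  The kernel is known only through its action on \<open>L2\<close>. The splitting of time t into
  halves is therefore carried out for the numbers (P_t 1_A, 1_A'), and a comparison of measures
  turns the resulting bounds on rectangles into a bound at almost every pair.\<close>

definition l2_inner :: "'a measure \<Rightarrow> ('a \<Rightarrow> real) \<Rightarrow> ('a \<Rightarrow> real) \<Rightarrow> real" where
  "l2_inner M f g = (\<integral>x. f x * g x \<partial>M)"

lemma L2_measurable [measurable_dest]: "f \<in> L2 M \<Longrightarrow> f \<in> borel_measurable M"
  by (simp add: L2_def)

lemma L2_square_integrable: "f \<in> L2 M \<Longrightarrow> integrable M (\<lambda>x. (f x)\<^sup>2)"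
  by (simp add: L2_def)

lemma L2_mult_integrable:
  assumes "f \<in> L2 M" "g \<in> L2 M"
  shows "integrable M (\<lambda>x. f x * g x)"
proof (rule Bochner_Integration.integrable_bound)
  show "integrable M (\<lambda>x. (f x)\<^sup>2 + (g x)\<^sup>2)"
    using assms by (intro Bochner_Integration.integrable_add L2_square_integrable)
  show "(\<lambda>x. f x * g x) \<in> borel_measurable M"
    using assms by measurable
  have "\<bar>a * b\<bar> \<le> a\<^sup>2 + b\<^sup>2" for a b :: real
  proof -
    have "2 * (\<bar>a\<bar> * \<bar>b\<bar>) \<le> a\<^sup>2 + b\<^sup>2"
      using sum_squares_bound[of "\<bar>a\<bar>" "\<bar>b\<bar>"] by (simp add: mult.assoc)
    moreover have "0 \<le> \<bar>a\<bar> * \<bar>b\<bar>" by simp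
    ultimately show ?thesis unfolding abs_mult by linarith
  qed
  then show "AE x in M. norm (f x * g x) \<le> norm ((f x)\<^sup>2 + (g x)\<^sup>2)"
    by (intro AE_I2) (metis abs_of_nonneg add_nonneg_nonneg real_norm_def zero_le_power2)
qed

lemma L2_bound:
  assumes "f \<in> L2 M" "g \<in> borel_measurable M" "\<And>x. \<bar>g x\<bar> \<le> \<bar>f x\<bar>"
  shows "g \<in> L2 M"
proof -
  have "integrable M (\<lambda>x. (g x)\<^sup>2)"
  proof (rule Bochner_Integration.integrable_bound[OF L2_square_integrable[OF assms(1)]])
    show "(\<lambda>x. (g x)\<^sup>2) \<in> borel_measurable M" using assms(2) by measurable
    show "AE x in M. norm ((g x)\<^sup>2) \<le> norm ((f x)\<^sup>2)"
      using assms(3) by (simp add: abs_le_square_iff)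
  qed
  with assms(2) show ?thesis by (simp add: L2_def)
qed

lemma L2_lincomb:
  assumes "f \<in> L2 M" "g \<in> L2 M"
  shows "(\<lambda>x. a * f x + g x) \<in> L2 M"
proof -
  have "(\<lambda>x. (a * f x + g x)\<^sup>2) = (\<lambda>x. a\<^sup>2 * (f x)\<^sup>2 + 2 * a * (f x * g x) + (g x)\<^sup>2)"
    by (auto simp: power2_eq_square algebra_simps)
  then have "integrable M (\<lambda>x. (a * f x + g x)\<^sup>2)"
    using assms by (simp add: L2_mult_integrable L2_square_integrable)
  with assms show ?thesis by (auto simp: L2_def)
qed

lemma L2_zero: "(\<lambda>x. 0) \<in> L2 M"
  by (simp add: L2_def)

lemma L2_add: "f \<in> L2 M \<Longrightarrow> g \<in> L2 M \<Longrightarrow> (\<lambda>x. f x + g x) \<in> L2 M"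
  using L2_lincomb[of f M g 1] by simp

lemma L2_diff: "f \<in> L2 M \<Longrightarrow> g \<in> L2 M \<Longrightarrow> (\<lambda>x. f x - g x) \<in> L2 M"
  using L2_lincomb[of g M f "-1"] by simp

lemma L2_uminus: "f \<in> L2 M \<Longrightarrow> (\<lambda>x. - f x) \<in> L2 M"
  using L2_diff[OF L2_zero] by simp

lemma L2_indicator:
  "A \<in> sets M \<Longrightarrow> emeasure M A < \<infinity> \<Longrightarrow> indicator A \<in> L2 M"
  by (simp add: L2_def power2_eq_square flip: indicator_inter_arith)

lemma L2_nn_integral:
  "f \<in> L2 M \<Longrightarrow> (\<integral>\<^sup>+x. ennreal ((f x)\<^sup>2) \<partial>M) = ennreal (l2_inner M f f)"
  by (simp add: L2_def nn_integral_eq_integral l2_inner_def power2_eq_square)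

lemma l2_inner_commute: "l2_inner M f g = l2_inner M g f"
  by (simp add: l2_inner_def mult.commute)

lemma l2_inner_add_left:
  "f \<in> L2 M \<Longrightarrow> g \<in> L2 M \<Longrightarrow> h \<in> L2 M \<Longrightarrow>
    l2_inner M (\<lambda>x. f x + g x) h = l2_inner M f h + l2_inner M g h"
  by (simp add: l2_inner_def distrib_right L2_mult_integrable)

lemma l2_inner_diff_left:
  "f \<in> L2 M \<Longrightarrow> g \<in> L2 M \<Longrightarrow> h \<in> L2 M \<Longrightarrow>
    l2_inner M (\<lambda>x. f x - g x) h = l2_inner M f h - l2_inner M g h"
  by (simp add: l2_inner_def left_diff_distrib L2_mult_integrable)

lemma l2_inner_add_right:
  "f \<in> L2 M \<Longrightarrow> g \<in> L2 M \<Longrightarrow> h \<in> L2 M \<Longrightarrow>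
    l2_inner M h (\<lambda>x. f x + g x) = l2_inner M h f + l2_inner M h g"
  by (simp add: l2_inner_commute[of M h] l2_inner_add_left)

lemma l2_inner_diff_right:
  "f \<in> L2 M \<Longrightarrow> g \<in> L2 M \<Longrightarrow> h \<in> L2 M \<Longrightarrow>
    l2_inner M h (\<lambda>x. f x - g x) = l2_inner M h f - l2_inner M h g"
  by (simp add: l2_inner_commute[of M h] l2_inner_diff_left)

lemma l2_inner_nonneg: "0 \<le> l2_inner M f f"
  by (simp add: l2_inner_def integral_nonneg_AE)

lemma l2_inner_cong_AE:
  assumes "f \<in> L2 M" "f' \<in> L2 M" "g \<in> L2 M" "g' \<in> L2 M"
    and "AE x in M. f x = f' x" "AE x in M. g x = g' x"
  shows "l2_inner M f g = l2_inner M f' g'"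
  unfolding l2_inner_def
proof (rule integral_cong_AE)
  show "AE x in M. f x * g x = f' x * g' x" using assms(5,6) by eventually_elim simp
qed (use assms in measurable)

lemma l2_inner_self_mono:
  assumes "f \<in> L2 M" "g \<in> L2 M" "\<And>x. \<bar>g x\<bar> \<le> \<bar>f x\<bar>"
  shows "l2_inner M g g \<le> l2_inner M f f"
  unfolding l2_inner_def using assms
  by (intro integral_mono L2_mult_integrable) (auto simp: abs_le_square_iff power2_eq_square[symmetric])

lemma l2_inner_young:
  assumes "f \<in> L2 M" "g \<in> L2 M" "\<epsilon> > 0"
  shows "2 * l2_inner M f g \<le> \<epsilon> * l2_inner M f f + l2_inner M g g / \<epsilon>"
proof -
  have "0 \<le> (\<integral>x. (\<epsilon> * f x - g x)\<^sup>2 / \<epsilon> \<partial>M)"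
    using assms(3) by (intro integral_nonneg_AE) auto
  also have "(\<lambda>x. (\<epsilon> * f x - g x)\<^sup>2 / \<epsilon>) = (\<lambda>x. \<epsilon> * (f x * f x) - 2 * (f x * g x) + g x * g x / \<epsilon>)"
    using assms(3) by (auto simp: power2_eq_square field_simps)
  also have "(\<integral>x. \<epsilon> * (f x * f x) - 2 * (f x * g x) + g x * g x / \<epsilon> \<partial>M)
      = \<epsilon> * l2_inner M f f - 2 * l2_inner M f g + l2_inner M g g / \<epsilon>"
    using assms(1,2) by (simp add: l2_inner_def L2_mult_integrable)
  finally show ?thesis by simp
qed

text \<open>Continuity of \<open>N\<close> is replaced by a left-hand condition that forbids upward
  jumps only. This condition puts the supremum of the times s with N s \<le> N a + \<epsilon> (s -
  a) among these times; the right-hand condition then moves beyond the supremum unless it is already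
  b.\<close>

lemma nonincreasing_if_right_Dini_nonpos:
  fixes N :: "real \<Rightarrow> real"
  assumes right: "\<And>t \<epsilon>. t > 0 \<Longrightarrow> \<epsilon> > 0 \<Longrightarrow> \<forall>\<^sub>F h in at_right 0. N (t + h) \<le> N t + \<epsilon> * h"
    and left: "\<And>t \<epsilon>. t > 0 \<Longrightarrow> \<epsilon> > 0 \<Longrightarrow> \<forall>\<^sub>F h in at_right 0. N t \<le> N (t - h) + \<epsilon>"
    and ab: "0 < a" "a \<le> b"
  shows "N b \<le> N a"
proof -
  have eps: "N b \<le> N a + \<epsilon> * (b - a)" if \<epsilon>: "\<epsilon> > 0" for \<epsilon>
  proof -
    define S where "S = {s. a \<le> s \<and> s \<le> b \<and> N s \<le> N a + \<epsilon> * (s - a)}"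
    define c where "c = Sup S"
    have aS: "a \<in> S" using ab by (simp add: S_def)
    have bdd: "bdd_above S" by (auto simp: S_def bdd_above_def)
    have ac: "a \<le> c" unfolding c_def by (rule cSup_upper[OF aS bdd])
    have cb: "c \<le> b" unfolding c_def using aS by (intro cSup_least) (auto simp: S_def)
    have "N c \<le> N a + \<epsilon> * (c - a) + \<delta>" if \<delta>: "\<delta> > 0" for \<delta>
    proof -
      obtain \<eta> where \<eta>: "\<eta> > 0" "\<And>h. 0 < h \<Longrightarrow> h < \<eta> \<Longrightarrow> N c \<le> N (c - h) + \<delta>"
        using left[of c \<delta>] ac ab \<delta> unfolding eventually_at_right_field by auto
      obtain s where s: "s \<in> S" "c - \<eta> < s"
        using less_cSup_iff[of S "c - \<eta>"] aS bdd \<eta>(1) by (auto simp: c_def)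
      have sc: "s \<le> c" unfolding c_def by (rule cSup_upper[OF s(1) bdd])
      have "N c \<le> N s + \<delta>"
        using \<eta>(2)[of "c - s"] s(2) sc \<delta> by (cases "s = c") auto
      also have "N s \<le> N a + \<epsilon> * (s - a)" using s(1) by (simp add: S_def)
      also have "\<epsilon> * (s - a) \<le> \<epsilon> * (c - a)" using sc \<epsilon> by simp
      finally show ?thesis by simp
    qed
    then have Nc: "N c \<le> N a + \<epsilon> * (c - a)" by (rule field_le_epsilon)
    have "c = b"
    proof (rule ccontr)
      assume "c \<noteq> b"
      with cb have "c < b" by simp
      obtain \<eta> where \<eta>: "\<eta> > 0" "\<And>h. 0 < h \<Longrightarrow> h < \<eta> \<Longrightarrow> N (c + h) \<le> N c + \<epsilon> * h"
        using right[of c \<epsilon>] ac ab \<epsilon> unfolding eventually_at_right_field by auto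
      define h where "h = min (\<eta> / 2) (b - c)"
      have h: "0 < h" "h < \<eta>" "c + h \<le> b" using \<eta>(1) \<open>c < b\<close> by (auto simp: h_def)
      have "N (c + h) \<le> N a + \<epsilon> * (c + h - a)"
        using \<eta>(2)[OF h(1,2)] Nc by (simp add: algebra_simps)
      then have "c + h \<in> S" using h ac by (simp add: S_def)
      then have "c + h \<le> c" unfolding c_def by (rule cSup_upper[OF _ bdd])
      with h show False by simp
    qed
    with Nc show ?thesis by simp
  qed
  show ?thesis
  proof (rule field_le_epsilon)
    fix e :: real assume "e > 0"
    \<comment> \<open>The summand 1 in the denominator covers the case a = b.\<close>
    have "N b \<le> N a + e / (b - a + 1) * (b - a)" using \<open>e > 0\<close> ab by (intro eps) simp
    also have "e / (b - a + 1) * (b - a) \<le> e"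
      using \<open>e > 0\<close> ab by (simp add: field_simps)
    finally show "N b \<le> N a + e" by simp
  qed
qed

section \<open>The approximating forms of a symmetric semigroup\<close>

locale heat_semigroup_form =
  fixes \<mu> :: "'a::metric_space measure" and j :: "('a \<times> 'a) measure"
    and P :: "real \<Rightarrow> ('a \<Rightarrow> real) \<Rightarrow> ('a \<Rightarrow> real)"
  assumes semigroup: "heat_semigroup \<mu> j P"
begin

abbreviation ip :: "('a \<Rightarrow> real) \<Rightarrow> ('a \<Rightarrow> real) \<Rightarrow> real" where
  "ip \<equiv> l2_inner \<mu>"

lemmas semigroup_laws = semigroup[unfolded heat_semigroup_def]

section \<open>Semigroup laws in terms of the inner product\<close>

lemma P_L2: "t > 0 \<Longrightarrow> f \<in> L2 \<mu> \<Longrightarrow> P t f \<in> L2 \<mu>"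
  using conjunct1[OF semigroup_laws] by blast

lemma P_lincomb:
  "t > 0 \<Longrightarrow> f \<in> L2 \<mu> \<Longrightarrow> g \<in> L2 \<mu> \<Longrightarrow>
    AE x in \<mu>. P t (\<lambda>y. a * f y + g y) x = a * P t f x + P t g x"
  using semigroup_laws[THEN conjunct2, THEN conjunct1] by blast

lemma P_symmetric: "t > 0 \<Longrightarrow> f \<in> L2 \<mu> \<Longrightarrow> g \<in> L2 \<mu> \<Longrightarrow> ip (P t f) g = ip f (P t g)"
  using semigroup_laws[THEN conjunct2, THEN conjunct2, THEN conjunct2, THEN conjunct1]
  unfolding l2_inner_def by blast

lemma P_contraction: "t > 0 \<Longrightarrow> f \<in> L2 \<mu> \<Longrightarrow> ip (P t f) (P t f) \<le> ip f f"
  using semigroup_laws[THEN conjunct2, THEN conjunct2, THEN conjunct2, THEN conjunct2, THEN conjunct1]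
  unfolding l2_inner_def power2_eq_square by blast

lemma P_semigroup:
  "s > 0 \<Longrightarrow> t > 0 \<Longrightarrow> f \<in> L2 \<mu> \<Longrightarrow> AE x in \<mu>. P (s + t) f x = P s (P t f) x"
  using semigroup_laws[THEN conjunct2, THEN conjunct2, THEN conjunct2, THEN conjunct2,
      THEN conjunct2, THEN conjunct1] by blast

lemma P_continuous:
  "f \<in> L2 \<mu> \<Longrightarrow>
    ((\<lambda>t. ip (\<lambda>x. P t f x - f x) (\<lambda>x. P t f x - f x)) \<longlongrightarrow> 0) (at_right 0)"
  using semigroup_laws[THEN conjunct2, THEN conjunct2, THEN conjunct2, THEN conjunct2,
      THEN conjunct2, THEN conjunct2, THEN conjunct1]
  unfolding l2_inner_def power2_eq_square by blast

lemma P_diff: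
  assumes "t > 0" "f \<in> L2 \<mu>" "g \<in> L2 \<mu>"
  shows "AE x in \<mu>. P t (\<lambda>y. f y - g y) x = P t f x - P t g x"
  using P_lincomb[OF assms(1,3,2), of "-1"] by simp

lemma P_uminus:
  assumes "t > 0" "f \<in> L2 \<mu>"
  shows "AE x in \<mu>. P t (\<lambda>y. - f y) x = - P t f x"
  using P_diff[OF assms assms(2)] P_diff[OF assms(1) L2_diff[OF assms(2,2)] assms(2)]
  by eventually_elim simp

lemma ip_P_add:
  assumes "t > 0" "f \<in> L2 \<mu>" "g \<in> L2 \<mu>" "h \<in> L2 \<mu>"
  shows "ip (P t (\<lambda>x. f x + g x)) h = ip (P t f) h + ip (P t g) h"
proof -
  have "ip (P t (\<lambda>x. f x + g x)) h = ip (\<lambda>x. P t f x + P t g x) h"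
    using P_lincomb[OF assms(1-3), of 1] assms by (intro l2_inner_cong_AE) (auto intro: P_L2 L2_add)
  then show ?thesis using assms by (simp add: l2_inner_add_left P_L2)
qed

lemma ip_P_diff:
  assumes "t > 0" "f \<in> L2 \<mu>" "g \<in> L2 \<mu>" "h \<in> L2 \<mu>"
  shows "ip (P t (\<lambda>x. f x - g x)) h = ip (P t f) h - ip (P t g) h"
proof -
  have "ip (P t (\<lambda>x. f x - g x)) h = ip (\<lambda>x. P t f x - P t g x) h"
    using P_diff[OF assms(1-3)] assms by (intro l2_inner_cong_AE) (auto intro: P_L2 L2_diff)
  then show ?thesis using assms by (simp add: l2_inner_diff_left P_L2)
qed

lemma ip_P_P:
  assumes "s > 0" "t > 0" "f \<in> L2 \<mu>" "g \<in> L2 \<mu>"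
  shows "ip (P s f) (P t g) = ip (P (s + t) f) g"
proof -
  have "ip (P s f) (P t g) = ip (P t (P s f)) g"
    using assms by (simp add: P_symmetric P_L2)
  also have "\<dots> = ip (P (t + s) f) g"
    using P_semigroup[OF assms(2,1,3)] assms by (intro l2_inner_cong_AE) (auto intro: P_L2)
  finally show ?thesis by (simp add: add.commute)
qed

lemma ip_P_nonneg:
  assumes "t > 0" "f \<in> L2 \<mu>"
  shows "0 \<le> ip (P t f) f"
proof -
  have "ip (P t f) f = ip (P (t/2) f) (P (t/2) f)"
    using assms by (simp add: ip_P_P)
  then show ?thesis by (simp add: l2_inner_nonneg)
qed

lemma ip_P_le:
  assumes "t > 0" "f \<in> L2 \<mu>"
  shows "ip (P t f) f \<le> ip f f"
proof -
  have "ip (P t f) f = ip (P (t/2) f) (P (t/2) f)"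
    using assms by (simp add: ip_P_P)
  then show ?thesis using P_contraction[of "t/2" f] assms by simp
qed

text \<open>The Deny-Yosida approximation of the Dirichlet form: for each t a bounded nonnegative
  symmetric form on all of \<open>L2\<close>, with \<open>En t f f\<close> tending to the energy as
  t decreases to 0.\<close>

definition En :: "real \<Rightarrow> ('a \<Rightarrow> real) \<Rightarrow> ('a \<Rightarrow> real) \<Rightarrow> real" where
  "En t f g = (ip f g - ip (P t f) g) / t"

lemma En_nonneg: "t > 0 \<Longrightarrow> f \<in> L2 \<mu> \<Longrightarrow> 0 \<le> En t f f"
  using ip_P_le[of t f] by (simp add: En_def)

lemma En_le_norm: "t > 0 \<Longrightarrow> f \<in> L2 \<mu> \<Longrightarrow> En t f f \<le> ip f f / t"
  using ip_P_nonneg[of t f] by (simp add: En_def divide_right_mono)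

lemma En_tendsto_ext_form:
  assumes "f \<in> L2 \<mu>"
  shows "((\<lambda>t. ennreal (En t f f)) \<longlongrightarrow> ext_form \<mu> j f) (at_right 0)"
proof -
  have "((\<lambda>t. ennreal ((1 / t) * (\<integral>x. (f x - P t f x) * f x \<partial>\<mu>))) \<longlongrightarrow> ext_form \<mu> j f) (at_right 0)"
    using semigroup_laws[THEN conjunct2, THEN conjunct2, THEN conjunct2, THEN conjunct2,
        THEN conjunct2, THEN conjunct2, THEN conjunct2] assms by blast
  moreover have "\<forall>\<^sub>F t in at_right 0.
      ennreal ((1 / t) * (\<integral>x. (f x - P t f x) * f x \<partial>\<mu>)) = ennreal (En t f f)"
    using eventually_at_right_less[of "0::real"]
  proof eventually_elim
    case (elim t)
    then show ?case
      using l2_inner_diff_left[OF assms P_L2[OF elim assms] assms]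
      by (simp add: En_def l2_inner_def)
  qed
  ultimately show ?thesis by (rule Lim_transform_eventually)
qed

lemma norm_P_diff:
  assumes "t > 0" "f \<in> L2 \<mu>"
  shows "ip (\<lambda>x. P t f x - f x) (\<lambda>x. P t f x - f x) = ip f f - 2 * ip (P t f) f + ip (P (2 * t) f) f"
proof -
  have "ip (\<lambda>x. P t f x - f x) (\<lambda>x. P t f x - f x) = ip (P t f) (P t f) - 2 * ip (P t f) f + ip f f"
    using assms by (simp add: l2_inner_diff_left l2_inner_diff_right L2_diff P_L2
        l2_inner_commute[of \<mu> f "P t f"])
  also have "ip (P t f) (P t f) = ip (P (2 * t) f) f"
    using assms by (simp add: ip_P_P)
  finally show ?thesis by simp
qed

lemma second_difference_nonneg:
  "t > 0 \<Longrightarrow> f \<in> L2 \<mu> \<Longrightarrow> 0 \<le> ip f f - 2 * ip (P t f) f + ip (P (2 * t) f) f"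
  using norm_P_diff l2_inner_nonneg by metis

text \<open>Nonnegativity of the left side makes \<open>En\<close> grow when t is halved.
  Convergence of both terms on the right makes the left side vanish in the limit for functions of
  finite energy.\<close>

lemma norm_P_diff_En:
  assumes "t > 0" "f \<in> L2 \<mu>"
  shows "ip (\<lambda>x. P t f x - f x) (\<lambda>x. P t f x - f x) / t = 2 * En t f f - 2 * En (2 * t) f f"
proof -
  have "2 * En t f f - 2 * En (2 * t) f f = (ip f f - 2 * ip (P t f) f + ip (P (2 * t) f) f) / t"
    using assms(1) by (simp add: En_def diff_divide_distrib add_divide_distrib)
  then show ?thesis using norm_P_diff[OF assms] by simp
qed

lemma En_double_le:
  assumes "t > 0" "f \<in> L2 \<mu>"
  shows "En (2 * t) f f \<le> En t f f"
proof -
  have "0 \<le> ip (\<lambda>x. P t f x - f x) (\<lambda>x. P t f x - f x) / t"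
    using assms(1) by (simp add: l2_inner_nonneg)
  then show ?thesis unfolding norm_P_diff_En[OF assms] by simp
qed

text \<open>Growth under halving is enough, because the limit over all t is known to exist and can
  be taken along t / 2^n.\<close>

lemma En_le_ext_form:
  assumes "t > 0" "f \<in> L2 \<mu>"
  shows "ennreal (En t f f) \<le> ext_form \<mu> j f"
proof -
  have mono: "En t f f \<le> En (t / 2 ^ n) f f" for n
  proof (induction n)
    case (Suc n)
    have "En (2 * (t / 2 ^ Suc n)) f f \<le> En (t / 2 ^ Suc n) f f"
      using assms by (intro En_double_le) simp_all
    with Suc show ?case by simp
  qed simp
  have "filterlim (\<lambda>n. t / 2 ^ n) (at_right 0) sequentially"
    unfolding filterlim_at using assms(1) LIMSEQ_divide_realpow_zero[of 2 t] by simp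
  then have "(\<lambda>n. ennreal (En (t / 2 ^ n) f f)) \<longlonglongrightarrow> ext_form \<mu> j f"
    by (rule filterlim_compose[OF En_tendsto_ext_form[OF assms(2)]])
  then show ?thesis
    by (rule LIMSEQ_le_const) (auto intro!: ennreal_leI mono)
qed

lemma ext_form_le:
  assumes "f \<in> L2 \<mu>" and "\<And>n. t n > 0" "t \<longlonglongrightarrow> 0" and "\<And>n. En (t n) f f \<le> C"
  shows "ext_form \<mu> j f \<le> ennreal C"
proof -
  have "filterlim t (at_right 0) sequentially"
    unfolding filterlim_at using assms(2,3) by (auto simp: less_imp_neq[symmetric])
  then have "(\<lambda>n. ennreal (En (t n) f f)) \<longlonglongrightarrow> ext_form \<mu> j f"
    by (rule filterlim_compose[OF En_tendsto_ext_form[OF assms(1)]])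
  then show ?thesis
    by (rule LIMSEQ_le_const2) (auto intro!: ennreal_leI assms)
qed

text \<open>Convexity of \<open>k \<mapsto> (P (k h) f, f)\<close> makes its decrements nonincreasing, so that the
  \<open>n\<close>-th one is at most \<open>1 / n\<close> times the total decrease.\<close>

lemma ext_form_P_finite:
  assumes "s > 0" "f \<in> L2 \<mu>"
  shows "ext_form \<mu> j (P s f) < \<infinity>"
proof -
  have bound: "En (2 * s / Suc n) (P s f) (P s f) \<le> ip f f / (2 * s)" for n
  proof -
    \<comment> \<open>The grid reaches time 2 s after n + 1 steps. Hence \<open>a (Suc n)\<close> is
      (P_s f, P_s f), and the next decrement is the numerator of
      \<open>En h (P s f) (P s f)\<close>.\<close>
    define h where "h = 2 * s / Suc n"
    have h: "h > 0" and nh: "real (Suc n) * h = 2 * s" using assms(1) by (simp_all add: h_def)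
    \<comment> \<open>The semigroup is specified at positive times only, so the value at time 0 is
      set by hand.\<close>
    define a where "a k = (if k = 0 then ip f f else ip (P (real k * h) f) f)" for k
    have conv: "a (Suc k) - a (Suc (Suc k)) \<le> a k - a (Suc k)" for k
    proof (cases "k = 0")
      case True
      have "0 \<le> ip f f - 2 * ip (P h f) f + ip (P (2 * h) f) f"
        by (rule second_difference_nonneg[OF h assms(2)])
      with True show ?thesis by (simp add: a_def)
    next
      case False
      \<comment> \<open>Splitting the time k h symmetrically gives (g, g) = a k and turns later
        values of \<open>a\<close> into (P_h g, g) and (P_2h g, g), so the second difference at k is
        one at 0.\<close>
      define g where "g = P (real k * h / 2) f"
      have k: "real k * h > 0" using False h by simp
      have g: "g \<in> L2 \<mu>" unfolding g_def using k assms by (intro P_L2) simp_all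
      have "0 \<le> ip g g - 2 * ip (P h g) g + ip (P (2 * h) g) g"
        by (rule second_difference_nonneg[OF h g])
      moreover have "ip g g = a k"
        using False k assms by (simp add: g_def ip_P_P a_def mult.commute)
      moreover have "ip (P t g) g = ip (P (real k * h + t) f) f" if "t > 0" for t
      proof -
        have "ip (P t g) g = ip g (P (t + real k * h / 2) f)"
          using P_semigroup[of t "real k * h / 2" f] that k assms g
          by (subst l2_inner_commute) (intro l2_inner_cong_AE; auto intro: P_L2 simp: g_def)
        then show ?thesis using that k assms by (simp add: g_def ip_P_P add_ac mult.commute)
      qed
      then have "ip (P h g) g = a (Suc k)" "ip (P (2 * h) g) g = a (Suc (Suc k))"
        using h by (simp_all add: a_def algebra_simps)
      ultimately show ?thesis by simp
    qed
    have dec: "a (Suc n) - a (Suc (Suc n)) \<le> a k - a (Suc k)" if "k \<le> Suc n" for k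
      using that
    proof (induction rule: inc_induct)
      case (step k)
      then show ?case using conv[of k] by simp
    qed simp
    have "real (Suc n) * (a (Suc n) - a (Suc (Suc n))) = (\<Sum>k<Suc n. a (Suc n) - a (Suc (Suc n)))"
      by simp
    also have "\<dots> \<le> (\<Sum>k<Suc n. a k - a (Suc k))"
      by (intro sum_mono dec) simp
    also have "\<dots> = a 0 - a (Suc n)" by (rule sum_lessThan_telescope')
    also have "\<dots> \<le> a 0"
      using ip_P_nonneg[of "real (Suc n) * h" f] h assms(2) by (simp add: a_def)
    finally have *: "real (Suc n) * (a (Suc n) - a (Suc (Suc n))) \<le> ip f f" by (simp add: a_def)
    have "ip (P h (P s f)) (P s f) = ip (P (h + s) f) (P s f)"
      using P_semigroup[of h s f] h assms by (intro l2_inner_cong_AE) (auto intro: P_L2)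
    also have "\<dots> = a (Suc (Suc n))"
    proof -
      have "h + s + s = real (Suc (Suc n)) * h" using nh by (simp add: algebra_simps)
      then show ?thesis using h assms by (simp add: ip_P_P a_def)
    qed
    finally have 1: "ip (P h (P s f)) (P s f) = a (Suc (Suc n))" .
    have 2: "ip (P s f) (P s f) = a (Suc n)"
      using assms nh by (simp add: ip_P_P a_def)
    have "En h (P s f) (P s f) = real (Suc n) * (a (Suc n) - a (Suc (Suc n))) / (2 * s)"
      unfolding En_def 1 2 using h assms(1) by (simp add: h_def)
    also have "\<dots> \<le> ip f f / (2 * s)"
      using * assms(1) by (intro divide_right_mono) auto
    finally show ?thesis by (simp add: h_def)
  qed
  have "(\<lambda>n. 2 * s * (1 / real (Suc n))) \<longlonglongrightarrow> 2 * s * 0"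
    by (intro tendsto_mult tendsto_const lim_inverse_n'[THEN LIMSEQ_Suc])
  then have "ext_form \<mu> j (P s f) \<le> ennreal (ip f f / (2 * s))"
    using assms bound by (intro ext_form_le[where t = "\<lambda>n. 2 * s / Suc n"]) (auto intro: P_L2)
  then show ?thesis by (simp add: order.strict_trans1)
qed

section \<open>Functions of finite energy\<close>

lemma En_add:
  assumes "t > 0" "f \<in> L2 \<mu>" "g \<in> L2 \<mu>"
  shows "En t (\<lambda>x. f x + g x) (\<lambda>x. f x + g x) = En t f f + 2 * En t f g + En t g g"
proof -
  have "ip (P t g) f = ip (P t f) g" "ip g f = ip f g"
    using P_symmetric[OF assms] l2_inner_commute by metis+
  then show ?thesis
    using assms by (simp add: En_def ip_P_add l2_inner_add_left l2_inner_add_right L2_add P_L2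
        diff_divide_distrib add_divide_distrib)
qed

lemma En_diff:
  assumes "t > 0" "f \<in> L2 \<mu>" "g \<in> L2 \<mu>"
  shows "En t (\<lambda>x. f x - g x) (\<lambda>x. f x - g x) = En t f f - 2 * En t f g + En t g g"
proof -
  have "ip (P t g) f = ip (P t f) g" "ip g f = ip f g"
    using P_symmetric[OF assms] l2_inner_commute by metis+
  then show ?thesis
    using assms by (simp add: En_def ip_P_diff l2_inner_diff_left l2_inner_diff_right L2_diff P_L2
        diff_divide_distrib add_divide_distrib)
qed

lemma En_add_le:
  assumes "t > 0" "f \<in> L2 \<mu>" "g \<in> L2 \<mu>"
  shows "En t (\<lambda>x. f x + g x) (\<lambda>x. f x + g x) \<le> 2 * En t f f + 2 * En t g g"
  using En_add[OF assms] En_diff[OF assms] En_nonneg[OF assms(1) L2_diff[OF assms(2,3)]] by simp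

lemma En_diff_le:
  assumes "t > 0" "f \<in> L2 \<mu>" "g \<in> L2 \<mu>"
  shows "En t (\<lambda>x. f x - g x) (\<lambda>x. f x - g x) \<le> 2 * En t f f + 2 * En t g g"
  using En_add[OF assms] En_diff[OF assms] En_nonneg[OF assms(1) L2_add[OF assms(2,3)]] by simp

text \<open>Equivalently, f is in \<open>L2\<close> and \<open>En t f f\<close> stays bounded over t
  > 0 (\<open>finite_form_bound\<close>, \<open>finite_formI\<close>). This criterion gives closure
  under sums, differences and limits without computing with the approximating sequences in
  \<open>form_domain\<close>.\<close>

definition finite_form :: "('a \<Rightarrow> real) \<Rightarrow> bool" where
  "finite_form f \<longleftrightarrow> f \<in> L2 \<mu> \<and> ext_form \<mu> j f < \<infinity>"

lemma finite_form_L2: "finite_form f \<Longrightarrow> f \<in> L2 \<mu>"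
  by (simp add: finite_form_def)

lemma finite_form_P: "s > 0 \<Longrightarrow> f \<in> L2 \<mu> \<Longrightarrow> finite_form (P s f)"
  using ext_form_P_finite P_L2 unfolding finite_form_def by blast

lemma finite_form_bound:
  assumes "finite_form f"
  shows "\<exists>C. \<forall>t>0. En t f f \<le> C"
proof (rule exI[of _ "enn2real (ext_form \<mu> j f)"], intro allI impI)
  fix t :: real assume "t > 0"
  then have "ennreal (En t f f) \<le> ext_form \<mu> j f"
    using assms by (intro En_le_ext_form) (auto simp: finite_form_def)
  also have "\<dots> = ennreal (enn2real (ext_form \<mu> j f))"
    using assms by (simp add: finite_form_def)
  finally show "En t f f \<le> enn2real (ext_form \<mu> j f)"
    by simp
qed

lemma finite_formI:
  assumes "f \<in> L2 \<mu>" "\<And>t. t > 0 \<Longrightarrow> En t f f \<le> C"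
  shows "finite_form f"
proof -
  have "ext_form \<mu> j f \<le> ennreal C"
    using assms LIMSEQ_inverse_real_of_nat by (intro ext_form_le[where t = "\<lambda>n. inverse (real (Suc n))"]) auto
  then show ?thesis using assms(1) by (simp add: finite_form_def order.strict_trans1)
qed

lemma finite_form_add:
  assumes "finite_form f" "finite_form g"
  shows "finite_form (\<lambda>x. f x + g x)"
proof -
  obtain C where C: "\<forall>t>0. En t f f \<le> C" using finite_form_bound[OF assms(1)] ..
  obtain D where D: "\<forall>t>0. En t g g \<le> D" using finite_form_bound[OF assms(2)] ..
  have "En t (\<lambda>x. f x + g x) (\<lambda>x. f x + g x) \<le> 2 * C + 2 * D" if "t > 0" for t
    using En_add_le[OF that assms[THEN finite_form_L2]] C[rule_format, OF that] D[rule_format, OF that] by linarith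
  then show ?thesis
    by (rule finite_formI[OF L2_add[OF assms[THEN finite_form_L2]]])
qed

lemma finite_form_diff:
  assumes "finite_form f" "finite_form g"
  shows "finite_form (\<lambda>x. f x - g x)"
proof -
  obtain C where C: "\<forall>t>0. En t f f \<le> C" using finite_form_bound[OF assms(1)] ..
  obtain D where D: "\<forall>t>0. En t g g \<le> D" using finite_form_bound[OF assms(2)] ..
  have "En t (\<lambda>x. f x - g x) (\<lambda>x. f x - g x) \<le> 2 * C + 2 * D" if "t > 0" for t
    using En_diff_le[OF that assms[THEN finite_form_L2]] C[rule_format, OF that] D[rule_format, OF that] by linarith
  then show ?thesis
    by (rule finite_formI[OF L2_diff[OF assms[THEN finite_form_L2]]])
qed

text \<open>A form of lower semicontinuity: for fixed t, \<open>En t\<close> is bounded on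
  \<open>L2\<close> by \<open>En_le_norm\<close>, so an energy bound survives convergence in
  \<open>L2\<close> alone. The factor 2 lost in \<open>En_diff_le\<close> is harmless, since only
  finiteness is claimed.\<close>

lemma finite_form_approx:
  assumes "f \<in> L2 \<mu>" and g: "\<And>n. g n \<in> L2 \<mu>"
    and conv: "(\<lambda>n. ip (\<lambda>x. g n x - f x) (\<lambda>x. g n x - f x)) \<longlonglongrightarrow> 0"
    and bound: "\<And>n. ext_form \<mu> j (g n) \<le> ennreal C" and "C \<ge> 0"
  shows "finite_form f"
proof (rule finite_formI[OF assms(1), where C = "2 * C"])
  fix t :: real assume t: "t > 0"
  have En_bound: "En t f f \<le> 2 * C + 2 / t * ip (\<lambda>x. g n x - f x) (\<lambda>x. g n x - f x)" for n
  proof -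
    have "ennreal (En t (g n) (g n)) \<le> ennreal C"
      using En_le_ext_form[OF t g] bound order_trans by blast
    then have 1: "En t (g n) (g n) \<le> C" using \<open>C \<ge> 0\<close> by simp
    have 2: "En t (\<lambda>x. g n x - f x) (\<lambda>x. g n x - f x) \<le> ip (\<lambda>x. g n x - f x) (\<lambda>x. g n x - f x) / t"
      using t assms(1) g by (intro En_le_norm L2_diff)
    have "En t f f = En t (\<lambda>x. g n x - (g n x - f x)) (\<lambda>x. g n x - (g n x - f x))" by simp
    also have "\<dots> \<le> 2 * En t (g n) (g n) + 2 * En t (\<lambda>x. g n x - f x) (\<lambda>x. g n x - f x)"
      using t assms(1) g by (intro En_diff_le L2_diff)
    also have "\<dots> \<le> 2 * C + 2 * (ip (\<lambda>x. g n x - f x) (\<lambda>x. g n x - f x) / t)"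
      using 1 2 by simp
    finally show ?thesis by simp
  qed
  have "(\<lambda>n. 2 * C + 2 / t * ip (\<lambda>x. g n x - f x) (\<lambda>x. g n x - f x)) \<longlonglongrightarrow> 2 * C + 2 / t * 0"
    by (intro tendsto_intros conv)
  then show "En t f f \<le> 2 * C" using En_bound by (intro LIMSEQ_le_const) auto
qed

lemma En_self_tendsto:
  assumes "finite_form f"
  shows "((\<lambda>t. En t f f) \<longlongrightarrow> enn2real (jump_energy j f)) (at_right 0)"
    and "jump_energy j f < \<infinity>"
proof -
  have fin: "ext_form \<mu> j f < \<infinity>"
    using assms unfolding finite_form_def by (rule conjunct2)
  then have e: "ext_form \<mu> j f = jump_energy j f"
    by (cases "f \<in> form_domain \<mu> j") (simp_all add: ext_form_def)
  with fin show "jump_energy j f < \<infinity>" by simp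
  have "((\<lambda>t. enn2real (ennreal (En t f f))) \<longlongrightarrow> enn2real (jump_energy j f)) (at_right 0)"
    using En_tendsto_ext_form[OF finite_form_L2[OF assms]] e fin
    by (intro tendsto_enn2real) simp_all
  moreover have "\<forall>\<^sub>F t in at_right 0. enn2real (ennreal (En t f f)) = En t f f"
    using eventually_at_right_less[of "0::real"]
    by eventually_elim (simp add: En_nonneg finite_form_L2[OF assms])
  ultimately show "((\<lambda>t. En t f f) \<longlongrightarrow> enn2real (jump_energy j f)) (at_right 0)"
    by (rule Lim_transform_eventually)
qed

text \<open>By \<open>norm_P_diff_En\<close> this is a difference of two quantities with the same
  finite limit. It makes the quadratic remainder in \<open>excess_step\<close> negligible to first
  order.\<close>

lemma norm_P_diff_little_o:
  assumes "finite_form f"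
  shows "((\<lambda>t. ip (\<lambda>x. P t f x - f x) (\<lambda>x. P t f x - f x) / t) \<longlongrightarrow> 0) (at_right 0)"
proof -
  have "((\<lambda>t. En (2 * t) f f) \<longlongrightarrow> enn2real (jump_energy j f)) (at_right 0)"
  proof (rule filterlim_compose[OF En_self_tendsto(1)[OF assms]])
    have "((\<lambda>t::real. 2 * t) \<longlongrightarrow> 2 * 0) (at_right 0)" by (intro tendsto_intros)
    moreover have "\<forall>\<^sub>F t::real in at_right 0. 2 * t > 0"
      using eventually_at_right_less[of "0::real"] by eventually_elim simp
    ultimately show "filterlim (\<lambda>t::real. 2 * t) (at_right 0) (at_right 0)"
      unfolding filterlim_at by (auto elim: eventually_mono)
  qed
  then have "((\<lambda>t. 2 * En t f f - 2 * En (2 * t) f f) \<longlongrightarrow>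
      2 * enn2real (jump_energy j f) - 2 * enn2real (jump_energy j f)) (at_right 0)"
    by (intro tendsto_intros En_self_tendsto(1)[OF assms])
  then have "((\<lambda>t. 2 * En t f f - 2 * En (2 * t) f f) \<longlongrightarrow> 0) (at_right 0)" by simp
  moreover have "\<forall>\<^sub>F t in at_right 0. 2 * En t f f - 2 * En (2 * t) f f
      = ip (\<lambda>x. P t f x - f x) (\<lambda>x. P t f x - f x) / t"
    using eventually_at_right_less[of "0::real"]
    by eventually_elim (simp add: norm_P_diff_En finite_form_L2[OF assms])
  ultimately show ?thesis by (rule Lim_transform_eventually)
qed

end

section \<open>Comparison for the jump semigroup\<close>

definition cut :: "'a set \<Rightarrow> real \<Rightarrow> ('a \<Rightarrow> real) \<Rightarrow> 'a \<Rightarrow> real" where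
  "cut A k v x = indicator A x * max 0 (v x - k)"

lemma cut_nonneg: "0 \<le> cut A k v x"
  by (simp add: cut_def)

lemma cut_abs_le: "0 \<le> k \<Longrightarrow> \<bar>cut A k v x\<bar> \<le> \<bar>v x\<bar>"
  by (auto simp: cut_def indicator_def)

lemma cut_abs_diff_le: "\<bar>cut A k u x - cut A k v x\<bar> \<le> \<bar>u x - v x\<bar>"
  by (auto simp: cut_def indicator_def max_def)

lemma cut_measurable [measurable]:
  assumes [measurable]: "A \<in> sets M" "v \<in> borel_measurable M"
  shows "cut A k v \<in> borel_measurable M"
  unfolding cut_def by measurable

lemma cut_L2:
  assumes "A \<in> sets M" "v \<in> L2 M" "0 \<le> k"
  shows "cut A k v \<in> L2 M"
  using assms by (intro L2_bound[OF assms(2)] cut_measurable cut_abs_le) (auto dest: L2_measurable)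

text \<open>Here x is the height above the level, d the increment of the function and e the rise of
  the level during one time step. The term e^2 is charged only where x is positive, since a constant
  need not be integrable.\<close>

lemma square_max_step:
  fixes x d e :: real
  assumes "0 \<le> e"
  shows "(max 0 (x + d - e))\<^sup>2 \<le> (max 0 x)\<^sup>2 + 2 * (max 0 x * d) - 2 * (e * max 0 x) + 2 * d\<^sup>2
    + 2 * (if 0 < x then e\<^sup>2 else 0)"
proof (cases "0 < x")
  case True
  have "(max 0 (x + d - e))\<^sup>2 \<le> (x + (d - e))\<^sup>2"
    by (auto simp: max_def algebra_simps)
  also have "\<dots> = x\<^sup>2 + 2 * (x * d) - 2 * (e * x) + (d - e)\<^sup>2"
    by (simp add: power2_eq_square algebra_simps)
  also have "(d - e)\<^sup>2 \<le> 2 * d\<^sup>2 + 2 * e\<^sup>2"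
    using zero_le_power2[of "d + e"] by (simp add: power2_eq_square algebra_simps)
  finally show ?thesis using True by simp
next
  case False
  then have "max 0 (x + d - e) \<le> \<bar>d\<bar>" using assms by auto
  then have "(max 0 (x + d - e))\<^sup>2 \<le> \<bar>d\<bar>\<^sup>2" by (intro power_mono) auto
  also have "\<dots> \<le> 2 * d\<^sup>2" by simp
  finally have "(max 0 (x + d - e))\<^sup>2 \<le> 2 * d\<^sup>2" .
  moreover have "max 0 x = 0" using False by simp
  ultimately show ?thesis using False by simp
qed

locale jump_heat_semigroup = heat_semigroup_form \<mu> j P
  for \<mu> :: "'a::{metric_space, second_countable_topology} measure"
    and j :: "('a \<times> 'a) measure" and P +
  fixes J :: "'a \<Rightarrow> 'a measure"
  assumes ultrametric: "\<And>x y z :: 'a. dist x y \<le> max (dist x z) (dist z y)"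
    and locally_compact: "locally compact (UNIV :: 'a set)"
    and radon: "radon_full_support \<mu>"
    and jump: "jump_measure j"
    and kernel: "jump_kernel \<mu> j J"
begin

section \<open>Symmetry and null sets of the jump measure\<close>

lemma sets_\<mu> [measurable_cong, simp]: "sets \<mu> = sets borel"
  using radon by (simp add: radon_full_support_def)

lemma space_\<mu> [simp]: "space \<mu> = UNIV"
  using sets_eq_imp_space_eq[OF sets_\<mu>] by simp

lemma sets_j [measurable_cong, simp]: "sets j = sets (borel \<Otimes>\<^sub>M borel)"
  unfolding borel_prod using jump unfolding jump_measure_def by (rule conjunct1)

lemma space_j [simp]: "space j = UNIV"
  using sets_eq_imp_space_eq[OF sets_j] by (simp add: space_pair_measure)

lemma borel_measurable_\<mu> [simp]: "borel_measurable \<mu> = borel_measurable borel"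
  by (rule measurable_cong_sets) simp_all

lemma j_swap:
  assumes [measurable]: "A \<in> sets (borel \<Otimes>\<^sub>M borel)"
  shows "emeasure j ((\<lambda>z. (snd z, fst z)) -` A) = emeasure j A"
proof -
  have "(\<lambda>z. (snd z, fst z)) -` A = (\<lambda>(x, y). (y, x)) ` A"
    by (auto simp: image_iff)
  moreover have "emeasure j ((\<lambda>(x, y). (y, x)) ` A) = emeasure j A"
    using jump[unfolded jump_measure_def, THEN conjunct2, THEN conjunct2, THEN conjunct1] assms
    by simp
  ultimately show ?thesis by simp
qed

lemma distr_swap: "distr j (borel \<Otimes>\<^sub>M borel) (\<lambda>z. (snd z, fst z)) = j"
  by (rule measure_eqI) (auto simp: emeasure_distr j_swap)

lemma nn_integral_swap:
  assumes [measurable]: "F \<in> borel_measurable (borel \<Otimes>\<^sub>M borel)"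
  shows "(\<integral>\<^sup>+z. F (snd z, fst z) \<partial>j) = (\<integral>\<^sup>+z. F z \<partial>j)"
proof -
  have "(\<integral>\<^sup>+z. F z \<partial>distr j (borel \<Otimes>\<^sub>M borel) (\<lambda>z. (snd z, fst z))) = (\<integral>\<^sup>+z. F (snd z, fst z) \<partial>j)"
    by (rule nn_integral_distr) measurable
  then show ?thesis by (simp add: distr_swap)
qed

lemma emeasure_j:
  "A \<in> sets (borel \<Otimes>\<^sub>M borel) \<Longrightarrow> emeasure j A = (\<integral>\<^sup>+x. emeasure (J x) (Pair x -` A) \<partial>\<mu>)"
  using kernel[unfolded jump_kernel_def, THEN conjunct2, THEN conjunct2] by simp

text \<open>Values of the semigroup are determined only almost everywhere in \<mu>. Disintegration
  along \<open>J\<close> and, for the second coordinate, the symmetry of \<open>j\<close> make such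
  statements usable inside integrals over \<open>j\<close>.\<close>

lemma AE_j_fst:
  assumes "AE x in \<mu>. Q x"
  shows "AE z in j. Q (fst z)"
proof -
  obtain N where N: "{x. \<not> Q x} \<subseteq> N" "N \<in> sets borel" "emeasure \<mu> N = 0"
    using AE_E[OF assms] by auto
  have "N \<times> UNIV \<in> sets (borel \<Otimes>\<^sub>M borel)" using N(2) by measurable
  then have "emeasure j (N \<times> UNIV) = (\<integral>\<^sup>+x. emeasure (J x) (Pair x -` (N \<times> UNIV)) \<partial>\<mu>)"
    by (rule emeasure_j)
  also have "\<dots> = (\<integral>\<^sup>+x. 0 \<partial>\<mu>)"
  proof (rule nn_integral_cong_AE)
    have "AE x in \<mu>. x \<notin> N" using N by (intro AE_not_in) (auto simp: null_sets_def)
    then show "AE x in \<mu>. emeasure (J x) (Pair x -` (N \<times> UNIV)) = 0"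
      by eventually_elim simp
  qed
  finally have "emeasure j (N \<times> UNIV) = 0" by simp
  then show ?thesis
    using N by (intro AE_I[where N = "N \<times> UNIV"]) (auto intro!: pair_measureI)
qed

lemma AE_j_snd:
  assumes "AE x in \<mu>. Q x"
  shows "AE z in j. Q (snd z)"
proof -
  obtain N where N: "{x. \<not> Q x} \<subseteq> N" "N \<in> sets borel" "emeasure \<mu> N = 0"
    using AE_E[OF assms] by auto
  have N': "N \<times> UNIV \<in> sets (borel \<Otimes>\<^sub>M borel)" "UNIV \<times> N \<in> sets (borel \<Otimes>\<^sub>M borel)"
    using N(2) by (auto intro!: pair_measureI)
  have "AE x in \<mu>. x \<notin> N" using N by (intro AE_not_in) (auto simp: null_sets_def)
  then have "AE z in j. z \<notin> N \<times> UNIV" using AE_j_fst[of "\<lambda>x. x \<notin> N"] by (auto elim: eventually_mono)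
  then have "emeasure j (N \<times> UNIV) = 0" using N'(1) by (subst (asm) AE_iff_measurable[where N = "N \<times> UNIV"]) auto
  moreover have "(\<lambda>z. (snd z, fst z)) -` (UNIV \<times> N) = N \<times> UNIV" by auto
  ultimately have "emeasure j (UNIV \<times> N) = 0" using j_swap[OF N'(2)] by metis
  then show ?thesis
    using N N' by (intro AE_I[where N = "UNIV \<times> N"]) auto
qed

section \<open>The bilinear jump form\<close>

definition jform :: "('a \<Rightarrow> real) \<Rightarrow> ('a \<Rightarrow> real) \<Rightarrow> real" where
  "jform v g = (\<integral>z. (v (fst z) - v (snd z)) * (g (fst z) - g (snd z)) \<partial>j)"

lemma finite_form_measurable: "finite_form f \<Longrightarrow> f \<in> borel_measurable borel"
  using L2_measurable[of f \<mu>] by (simp add: finite_form_def)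

lemma finite_form_energy:
  assumes "finite_form f"
  shows "integrable j (\<lambda>z. (f (fst z) - f (snd z))\<^sup>2)"
    and "enn2real (jump_energy j f) = (\<integral>z. (f (fst z) - f (snd z))\<^sup>2 \<partial>j)"
proof -
  note [measurable] = finite_form_measurable[OF assms]
  show "integrable j (\<lambda>z. (f (fst z) - f (snd z))\<^sup>2)"
    using En_self_tendsto(2)[OF assms] by (intro integrableI_nonneg) (auto simp: jump_energy_def)
  show "enn2real (jump_energy j f) = (\<integral>z. (f (fst z) - f (snd z))\<^sup>2 \<partial>j)"
    unfolding jump_energy_def by (rule integral_eq_nn_integral[symmetric]) auto
qed

text \<open>Polarisation: \<open>heat_semigroup\<close> gives convergence on the diagonal only, so
  products are written through the squares of the sum and of the difference, both in
  \<open>En\<close> and under the integral.\<close>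

lemma En_tendsto_jform:
  assumes v: "finite_form v" and g: "finite_form g"
  shows "((\<lambda>t. En t v g) \<longlongrightarrow> jform v g) (at_right 0)"
    and "integrable j (\<lambda>z. (v (fst z) - v (snd z)) * (g (fst z) - g (snd z)))"
proof -
  define s where "s = (\<lambda>x. v x + g x)"
  define d where "d = (\<lambda>x. v x - g x)"
  have sd: "finite_form s" "finite_form d"
    unfolding s_def d_def using v g by (auto intro: finite_form_add finite_form_diff)
  have eq: "(v (fst z) - v (snd z)) * (g (fst z) - g (snd z))
      = ((s (fst z) - s (snd z))\<^sup>2 - (d (fst z) - d (snd z))\<^sup>2) / 4" for z :: "'a \<times> 'a"
    by (simp add: s_def d_def power2_eq_square algebra_simps)
  show "integrable j (\<lambda>z. (v (fst z) - v (snd z)) * (g (fst z) - g (snd z)))"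
    unfolding eq using sd by (simp add: finite_form_energy(1))
  have jf: "jform v g = (enn2real (jump_energy j s) - enn2real (jump_energy j d)) / 4"
    unfolding jform_def eq using sd by (simp add: finite_form_energy)
  have "((\<lambda>t. (En t s s - En t d d) / 4) \<longlongrightarrow>
      (enn2real (jump_energy j s) - enn2real (jump_energy j d)) / 4) (at_right 0)"
    by (intro tendsto_intros En_self_tendsto sd) simp
  moreover have "\<forall>\<^sub>F t in at_right 0. (En t s s - En t d d) / 4 = En t v g"
    using eventually_at_right_less[of "0::real"]
  proof eventually_elim
    case (elim t)
    then show ?case
      using En_add[OF elim v[THEN finite_form_L2] g[THEN finite_form_L2]]
        En_diff[OF elim v[THEN finite_form_L2] g[THEN finite_form_L2]]
      by (simp add: s_def d_def)
  qed
  ultimately show "((\<lambda>t. En t v g) \<longlongrightarrow> jform v g) (at_right 0)"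
    unfolding jf by (rule Lim_transform_eventually)
qed

section \<open>Ultrametric balls and the core of the form\<close>

lemma cball_open: "r > 0 \<Longrightarrow> open (cball (x :: 'a) r)"
  unfolding open_contains_cball
proof (intro ballI exI conjI subsetI)
  fix y z assume "r > 0" "y \<in> cball x r" "z \<in> cball y r"
  then show "z \<in> cball x r" using ultrametric[of x z y] by (auto simp: max_def split: if_splits)
qed

lemma cball_eq: "y \<in> cball x r \<Longrightarrow> cball y r = cball (x :: 'a) r"
proof (intro set_eqI iffI)
  fix z assume "y \<in> cball x r" "z \<in> cball y r"
  then show "z \<in> cball x r" using ultrametric[of x z y] by (auto simp: max_def split: if_splits)
next
  fix z assume "y \<in> cball x r" "z \<in> cball x r"
  then show "z \<in> cball y r"
    using ultrametric[of y z x] by (auto simp: max_def dist_commute split: if_splits)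
qed

lemma is_ball_Int:
  fixes A B :: "'a set"
  assumes "is_ball A" "is_ball B" "A \<inter> B \<noteq> {}"
  shows "is_ball (A \<inter> B)"
proof -
  obtain z where z: "z \<in> A" "z \<in> B" using assms(3) by blast
  obtain x r y s where "0 < r" "A = cball x r" "0 < s" "B = cball y s"
    using assms unfolding is_ball_def by blast
  with z have "A = cball z r" "B = cball z s" using cball_eq[of z x r] cball_eq[of z y s] by blast+
  then have "A \<inter> B = cball z (min r s)" by auto
  with \<open>0 < r\<close> \<open>0 < s\<close> show ?thesis
    unfolding is_ball_def by (intro exI[of _ z] exI[of _ "min r s"]) simp
qed

lemma simple_ball_function_times_ball:
  assumes "u \<in> simple_ball_functions" "is_ball (A :: 'a set)"
  shows "(\<lambda>x. indicator A x * u x) \<in> simple_ball_functions"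
proof -
  obtain I :: "nat set" and c B where I: "finite I" "\<And>i. i \<in> I \<Longrightarrow> is_ball (B i)"
    "\<And>i. i \<in> I \<Longrightarrow> compact (B i)" "disjoint_family_on B I" "u = (\<lambda>x. \<Sum>i\<in>I. c i * indicator (B i) x)"
    using assms(1) unfolding simple_ball_functions_def by blast
  \<comment> \<open>The empty set is not a ball, so only the balls that meet \<open>A\<close> can be
    kept.\<close>
  define I' where "I' = {i\<in>I. A \<inter> B i \<noteq> {}}"
  have "closed A" using assms(2) by (auto simp: is_ball_def)
  then have "\<forall>i\<in>I'. is_ball (A \<inter> B i) \<and> compact (A \<inter> B i)"
    using I assms(2) by (auto simp: I'_def intro!: is_ball_Int closed_Int_compact)
  moreover have "disjoint_family_on (\<lambda>i. A \<inter> B i) I'"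
    using I(4) by (auto simp: disjoint_family_on_def I'_def)
  moreover have "(\<lambda>x. indicator A x * u x) = (\<lambda>x. \<Sum>i\<in>I'. c i * indicator (A \<inter> B i) x)"
  proof
    fix x
    have "indicator A x * u x = (\<Sum>i\<in>I. c i * indicator (A \<inter> B i) x)"
      unfolding I(5) sum_distrib_left by (intro sum.cong) (auto simp: indicator_def)
    also have "\<dots> = (\<Sum>i\<in>I'. c i * indicator (A \<inter> B i) x)"
      using I(1) by (intro sum.mono_neutral_right) (auto simp: I'_def)
    finally show "indicator A x * u x = (\<Sum>i\<in>I'. c i * indicator (A \<inter> B i) x)" .
  qed
  moreover have "finite I'" using I(1) by (simp add: I'_def)
  ultimately show ?thesis unfolding simple_ball_functions_def mem_Collect_eq
    by (intro exI[of _ I'] exI[of _ c] exI[of _ "\<lambda>i. A \<inter> B i"] conjI)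
qed

text \<open>Since the balls are disjoint, \<phi> acts on the coefficients; the condition \<phi> 0 =
  0 takes care of the points outside all of them.\<close>

lemma simple_ball_function_comp:
  assumes "u \<in> simple_ball_functions" "\<phi> 0 = (0::real)"
  shows "(\<lambda>x::'a. \<phi> (u x)) \<in> simple_ball_functions"
proof -
  obtain I :: "nat set" and c B where I: "finite I" "\<And>i. i \<in> I \<Longrightarrow> is_ball (B i)"
    "\<And>i. i \<in> I \<Longrightarrow> compact (B i)" "disjoint_family_on B I" "u = (\<lambda>x. \<Sum>i\<in>I. c i * indicator (B i) x)"
    using assms(1) unfolding simple_ball_functions_def by blast
  have "\<phi> (u x) = (\<Sum>i\<in>I. \<phi> (c i) * indicator (B i) x)" for x
  proof (cases "\<exists>i\<in>I. x \<in> B i")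
    case True
    then obtain i where i: "i \<in> I" "x \<in> B i" by blast
    have other: "x \<notin> B k" if "k \<in> I" "k \<noteq> i" for k
      using I(4) i that by (auto simp: disjoint_family_on_def)
    have "(\<Sum>k\<in>I. a k * indicator (B k) x) = a i" for a :: "nat \<Rightarrow> real"
    proof -
      have "(\<Sum>k\<in>I. a k * indicator (B k) x) = (\<Sum>k\<in>I. if k = i then a i else 0)"
        using other i by (intro sum.cong) auto
      then show ?thesis using I(1) i by simp
    qed
    then show ?thesis by (simp add: I(5))
  next
    case False
    then have "(\<Sum>k\<in>I. a k * indicator (B k) x) = 0" for a :: "nat \<Rightarrow> real"
      by (intro sum.neutral) auto
    then show ?thesis by (simp add: I(5) assms(2))
  qed
  then show ?thesis using I(1-4) unfolding simple_ball_functions_def mem_Collect_eq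
    by (intro exI[of _ I] exI[of _ "\<lambda>i. \<phi> (c i)"] exI[of _ B] conjI) auto
qed

lemma simple_ball_function_L2:
  assumes "u \<in> simple_ball_functions"
  shows "u \<in> L2 \<mu>"
proof -
  obtain I :: "nat set" and c B where I: "finite I" "\<And>i. i \<in> I \<Longrightarrow> is_ball (B i)"
    "\<And>i. i \<in> I \<Longrightarrow> compact (B i)" "disjoint_family_on B I" "u = (\<lambda>x. \<Sum>i\<in>I. c i * indicator (B i) x)"
    using assms(1) unfolding simple_ball_functions_def by blast
  have "K \<subseteq> I \<Longrightarrow> (\<lambda>x. \<Sum>i\<in>K. c i * indicator (B i) x) \<in> L2 \<mu>" if "finite K" for K
    using that
  proof (induction K)
    case empty
    then show ?case by (simp add: L2_zero)
  next
    case (insert i K)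
    have "indicator (B i) \<in> L2 \<mu>"
      using I(3)[of i] insert radon by (intro L2_indicator) (auto simp: radon_full_support_def borel_compact)
    moreover have "(\<lambda>x. \<Sum>i\<in>K. c i * indicator (B i) x) \<in> L2 \<mu>" using insert by blast
    ultimately show ?case using L2_lincomb by (simp only: sum.insert[OF insert(1,2)])
  qed
  from this[OF I(1)] show ?thesis by (simp add: I(5))
qed

lemma simple_ball_function_form_domain:
  assumes "u \<in> simple_ball_functions"
  shows "u \<in> form_domain \<mu> j"
proof -
  have "(\<lambda>n::nat. \<integral>\<^sup>+x. ennreal ((u x - u x)\<^sup>2) \<partial>\<mu>) \<longlonglongrightarrow> 0"
    "(\<lambda>n::nat. jump_energy j (\<lambda>x. u x - u x)) \<longlonglongrightarrow> 0"
    by (simp_all add: jump_energy_def)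
  then show ?thesis
    using assms simple_ball_function_L2[OF assms] unfolding form_domain_def mem_Collect_eq
    by (intro conjI exI[of _ "\<lambda>n. u"]) simp_all
qed

text \<open>The last condition bounds by \<open>\<Lambda>\<close> the rate of jumps out of \<open>A\<close>; the one on the core ensures that
  restricting to \<open>A\<close> preserves the form domain.\<close>

definition jump_rate :: "'a set \<Rightarrow> real \<Rightarrow> bool" where
  "jump_rate A \<Lambda> \<longleftrightarrow> A \<in> sets borel \<and> 0 \<le> \<Lambda> \<and>
     (\<forall>u\<in>simple_ball_functions. (\<lambda>x. indicator A x * u x) \<in> simple_ball_functions) \<and>
     (\<forall>\<phi>\<in>borel_measurable borel.
        (\<integral>\<^sup>+z. \<phi> (fst z) * indicator (A \<times> - A) z \<partial>j) \<le> ennreal \<Lambda> * (\<integral>\<^sup>+x. \<phi> x \<partial>\<mu>))"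

lemma jump_rate_UNIV: "jump_rate UNIV 0"
  by (simp add: jump_rate_def)

text \<open>The kernel identity for \<open>j\<close> is stated for sets. Comparing two measures on
  the first coordinate extends it to the integrals of functions of that coordinate. The hypothesis
  speaks of balls centred at x, and each x in the fixed ball is a centre of it.\<close>

lemma jump_rate_ball:
  assumes r: "r > 0" and C: "C \<ge> 0" and J: "\<And>x. emeasure (J x) (- cball x r) \<le> ennreal C"
  shows "jump_rate (cball x0 r) C"
proof -
  let ?B = "cball x0 r"
  have B: "is_ball ?B" using r by (auto simp: is_ball_def)
  have [measurable]: "?B \<in> sets borel" "- ?B \<in> sets borel" by auto
  have "(\<integral>\<^sup>+z. \<phi> (fst z) * indicator (?B \<times> - ?B) z \<partial>j) \<le> ennreal C * (\<integral>\<^sup>+x. \<phi> x \<partial>\<mu>)"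
    if [measurable]: "\<phi> \<in> borel_measurable borel" for \<phi>
  proof -
    have Jm [measurable]: "(\<lambda>x. emeasure (J x) (- ?B)) \<in> borel_measurable borel"
      using kernel[unfolded jump_kernel_def, THEN conjunct2, THEN conjunct1] by simp
    \<comment> \<open>Both measures send A to the \<open>j\<close>-measure of the jumps that start
      in A and the ball and end outside the ball.\<close>
    define \<nu> where "\<nu> = distr (density j (indicator (?B \<times> - ?B))) borel fst"
    define \<nu>' where "\<nu>' = density \<mu> (\<lambda>x. emeasure (J x) (- ?B) * indicator ?B x)"
    have "\<nu> = \<nu>'"
    proof (rule measure_eqI)
      show "sets \<nu> = sets \<nu>'" by (simp add: \<nu>_def \<nu>'_def)
      fix A assume "A \<in> sets \<nu>"
      then have A [measurable]: "A \<in> sets borel" by (simp add: \<nu>_def)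
      have "emeasure \<nu> A = (\<integral>\<^sup>+z. indicator (?B \<times> - ?B) z * indicator (fst -` A) z \<partial>j)"
      proof -
        have "fst -` A = A \<times> (UNIV :: 'a set)" by auto
        then have [measurable]: "(fst -` A :: ('a \<times> 'a) set) \<in> sets (borel \<Otimes>\<^sub>M borel)" by simp
        have "fst \<in> measurable (density j (indicator (?B \<times> - ?B))) borel" by measurable
        then show ?thesis unfolding \<nu>_def
          by (subst emeasure_distr) (simp_all add: emeasure_density)
      qed
      also have "\<dots> = (\<integral>\<^sup>+z. indicator ((A \<inter> ?B) \<times> - ?B) z \<partial>j)"
        by (intro nn_integral_cong) (auto simp: indicator_def)
      also have "\<dots> = emeasure j ((A \<inter> ?B) \<times> - ?B)" by (intro nn_integral_indicator) simp
      also have "\<dots> = (\<integral>\<^sup>+x. emeasure (J x) (Pair x -` ((A \<inter> ?B) \<times> - ?B)) \<partial>\<mu>)"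
        by (intro emeasure_j) simp
      also have "\<dots> = (\<integral>\<^sup>+x. emeasure (J x) (- ?B) * indicator ?B x * indicator A x \<partial>\<mu>)"
        by (intro nn_integral_cong) (auto simp: indicator_def)
      also have "\<dots> = emeasure \<nu>' A"
        unfolding \<nu>'_def by (subst emeasure_density) auto
      finally show "emeasure \<nu> A = emeasure \<nu>' A" .
    qed
    have "(\<integral>\<^sup>+z. \<phi> (fst z) * indicator (?B \<times> - ?B) z \<partial>j) = (\<integral>\<^sup>+x. \<phi> x \<partial>\<nu>)"
      unfolding \<nu>_def by (simp add: nn_integral_distr nn_integral_density mult.commute)
    also have "\<dots> = (\<integral>\<^sup>+x. emeasure (J x) (- ?B) * indicator ?B x * \<phi> x \<partial>\<mu>)"
      unfolding \<open>\<nu> = \<nu>'\<close> \<nu>'_def by (intro nn_integral_density) auto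
    also have "\<dots> \<le> (\<integral>\<^sup>+x. ennreal C * \<phi> x \<partial>\<mu>)"
    proof (rule nn_integral_mono)
      fix x
      show "emeasure (J x) (- ?B) * indicator ?B x * \<phi> x \<le> ennreal C * \<phi> x"
      proof (cases "x \<in> ?B")
        case True
        then have "emeasure (J x) (- ?B) \<le> ennreal C" using J[of x] cball_eq[OF True] by simp
        then show ?thesis using True by (simp add: mult_right_mono)
      qed simp
    qed
    also have "\<dots> = ennreal C * (\<integral>\<^sup>+x. \<phi> x \<partial>\<mu>)" by (intro nn_integral_cmult) simp
    finally show ?thesis .
  qed
  then show ?thesis
    unfolding jump_rate_def using C simple_ball_function_times_ball[OF _ B] \<open>?B \<in> sets borel\<close> by simp
qed

section \<open>Cutting functions off at a set of bounded jump rate\<close>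

lemma jump_rateD:
  assumes "jump_rate A \<Lambda>"
  shows "A \<in> sets borel" "0 \<le> \<Lambda>"
    and "\<And>u. u \<in> simple_ball_functions \<Longrightarrow> (\<lambda>x. indicator A x * u x) \<in> simple_ball_functions"
    and "\<And>\<phi>. \<phi> \<in> borel_measurable borel \<Longrightarrow>
        (\<integral>\<^sup>+z. \<phi> (fst z) * indicator (A \<times> - A) z \<partial>j) \<le> ennreal \<Lambda> * (\<integral>\<^sup>+x. \<phi> x \<partial>\<mu>)"
    and "\<And>\<phi>. \<phi> \<in> borel_measurable borel \<Longrightarrow>
        (\<integral>\<^sup>+z. \<phi> (snd z) * indicator (A \<times> - A) (snd z, fst z) \<partial>j) \<le> ennreal \<Lambda> * (\<integral>\<^sup>+x. \<phi> x \<partial>\<mu>)"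
proof -
  show A: "A \<in> sets borel" "0 \<le> \<Lambda>"
    and "\<And>u. u \<in> simple_ball_functions \<Longrightarrow> (\<lambda>x. indicator A x * u x) \<in> simple_ball_functions"
    and *: "\<And>\<phi>. \<phi> \<in> borel_measurable borel \<Longrightarrow>
        (\<integral>\<^sup>+z. \<phi> (fst z) * indicator (A \<times> - A) z \<partial>j) \<le> ennreal \<Lambda> * (\<integral>\<^sup>+x. \<phi> x \<partial>\<mu>)"
    using assms by (simp_all add: jump_rate_def)
  fix \<phi> :: "'a \<Rightarrow> ennreal" assume [measurable]: "\<phi> \<in> borel_measurable borel"
  note [measurable] = A(1)
  have "(\<integral>\<^sup>+z. \<phi> (snd z) * indicator (A \<times> - A) (snd z, fst z) \<partial>j)
      = (\<integral>\<^sup>+z. \<phi> (fst z) * indicator (A \<times> - A) z \<partial>j)"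
    using nn_integral_swap[of "\<lambda>z. \<phi> (fst z) * indicator (A \<times> - A) z"] by simp
  then show "(\<integral>\<^sup>+z. \<phi> (snd z) * indicator (A \<times> - A) (snd z, fst z) \<partial>j) \<le> ennreal \<Lambda> * (\<integral>\<^sup>+x. \<phi> x \<partial>\<mu>)"
    using *[of \<phi>] by simp
qed

text \<open>On pairs inside \<open>A\<close> the cut is a contraction. A pair with exactly one point
  x in \<open>A\<close> contributes at most (u x)^2, and the jump rate controls the integral of
  this; the two orders of such a pair give the factor 2.\<close>

lemma jump_energy_cut_le:
  assumes A: "jump_rate A \<Lambda>" and [measurable]: "u \<in> borel_measurable borel" and k: "0 \<le> k"
  shows "jump_energy j (cut A k u) \<le> jump_energy j u + 2 * ennreal \<Lambda> * (\<integral>\<^sup>+x. ennreal ((u x)\<^sup>2) \<partial>\<mu>)"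
proof -
  note [measurable] = jump_rateD(1)[OF A]
  let ?F = "\<lambda>z. ennreal ((u (fst z))\<^sup>2) * indicator (A \<times> - A) z"
  let ?G = "\<lambda>z. ennreal ((u (snd z))\<^sup>2) * indicator (A \<times> - A) (snd z, fst z)"
  have "jump_energy j (cut A k u) \<le> (\<integral>\<^sup>+z. ennreal ((u (fst z) - u (snd z))\<^sup>2) + (?F z + ?G z) \<partial>j)"
    unfolding jump_energy_def
  proof (rule nn_integral_mono)
    fix z :: "'a \<times> 'a"
    obtain x y where z: "z = (x, y)" by force
    have "(max 0 (u x - k) - max 0 (u y - k))\<^sup>2 \<le> (u x - u y)\<^sup>2"
      by (subst abs_le_square_iff[symmetric]) auto
    moreover have "(max 0 (u x - k))\<^sup>2 \<le> (u x)\<^sup>2" for x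
      using k by (subst abs_le_square_iff[symmetric]) auto
    then have "ennreal ((max 0 (u x - k))\<^sup>2) \<le> ennreal ((u x - u y)\<^sup>2) + ennreal ((u x)\<^sup>2)"
      "ennreal ((max 0 (u y - k))\<^sup>2) \<le> ennreal ((u x - u y)\<^sup>2) + ennreal ((u y)\<^sup>2)"
      by (auto intro!: add_increasing ennreal_leI)
    ultimately show "ennreal ((cut A k u (fst z) - cut A k u (snd z))\<^sup>2)
        \<le> ennreal ((u (fst z) - u (snd z))\<^sup>2) + (?F z + ?G z)"
      by (cases "x \<in> A"; cases "y \<in> A") (simp_all add: z cut_def ennreal_leI)
  qed
  also have "\<dots> = jump_energy j u + ((\<integral>\<^sup>+z. ?F z \<partial>j) + (\<integral>\<^sup>+z. ?G z \<partial>j))"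
    unfolding jump_energy_def by (subst nn_integral_add, measurable)+
  also have "\<dots> \<le> jump_energy j u + (ennreal \<Lambda> * (\<integral>\<^sup>+x. ennreal ((u x)\<^sup>2) \<partial>\<mu>)
      + ennreal \<Lambda> * (\<integral>\<^sup>+x. ennreal ((u x)\<^sup>2) \<partial>\<mu>))"
    using jump_rateD(4)[OF A, of "\<lambda>x. ennreal ((u x)\<^sup>2)"]
      jump_rateD(5)[OF A, of "\<lambda>x. ennreal ((u x)\<^sup>2)"]
    by (intro add_left_mono add_mono) simp_all
  also have "\<dots> = jump_energy j u + 2 * ennreal \<Lambda> * (\<integral>\<^sup>+x. ennreal ((u x)\<^sup>2) \<partial>\<mu>)"
    by (simp add: mult_2 distrib_right)
  finally show ?thesis .
qed

lemma cut_simple_ball_function: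
  assumes A: "jump_rate A \<Lambda>" and u: "u \<in> simple_ball_functions" and k: "0 \<le> k"
  shows "cut A k u \<in> simple_ball_functions"
proof -
  have "(\<lambda>x. max 0 (u x - k)) \<in> simple_ball_functions"
    using k by (intro simple_ball_function_comp[OF u, of "\<lambda>s. max 0 (s - k)"]) simp
  then show ?thesis using jump_rateD(3)[OF A] by (simp add: cut_def[abs_def])
qed

lemma finite_form_cut:
  assumes A: "jump_rate A \<Lambda>" and v: "finite_form v" and k: "0 \<le> k"
  shows "finite_form (cut A k v)"
proof -
  have vL [simp]: "v \<in> L2 \<mu>" using v by (rule finite_form_L2)
  have [measurable]: "v \<in> borel_measurable borel" using v by (rule finite_form_measurable)
  have fin: "ext_form \<mu> j v < \<infinity>" using v unfolding finite_form_def by (rule conjunct2)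
  then have "v \<in> form_domain \<mu> j" by (cases "v \<in> form_domain \<mu> j") (simp_all add: ext_form_def)
  then obtain u where u: "\<And>n. u n \<in> simple_ball_functions"
    and conv: "(\<lambda>n. (\<integral>\<^sup>+ x. ennreal ((u n x - v x)\<^sup>2) \<partial>\<mu>)) \<longlonglongrightarrow> 0"
    and conv': "(\<lambda>n. jump_energy j (\<lambda>x. u n x - v x)) \<longlonglongrightarrow> 0"
    unfolding form_domain_def by auto
  have uL: "u n \<in> L2 \<mu>" for n using u by (rule simple_ball_function_L2)
  then have um [measurable]: "u n \<in> borel_measurable borel" for n
    using L2_measurable[of "u n" \<mu>] by simp
  have Ab: "A \<in> sets \<mu>" using jump_rateD(1)[OF A] by simp
  define d where "d n = l2_inner \<mu> (\<lambda>x. u n x - v x) (\<lambda>x. u n x - v x)" for n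
  have d_nn: "(\<integral>\<^sup>+ x. ennreal ((u n x - v x)\<^sup>2) \<partial>\<mu>) = ennreal (d n)" for n
    unfolding d_def by (rule L2_nn_integral) (simp add: L2_diff uL)
  have d0: "d \<longlonglongrightarrow> 0"
  proof -
    have "(\<lambda>n. enn2real (ennreal (d n))) \<longlonglongrightarrow> enn2real 0"
      using conv unfolding d_nn by (intro tendsto_enn2real) simp_all
    moreover have "0 \<le> d n" for n by (simp add: d_def l2_inner_nonneg)
    ultimately show ?thesis by simp
  qed
  have ev: "\<forall>\<^sub>F n in sequentially. d n \<le> 1 \<and> jump_energy j (\<lambda>x. u n x - v x) \<le> 1"
  proof -
    have "\<forall>\<^sub>F n in sequentially. d n < 1" using d0 by (rule order_tendstoD) simp
    moreover have "\<forall>\<^sub>F n in sequentially. jump_energy j (\<lambda>x. u n x - v x) < 1"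
      using conv' by (rule order_tendstoD) simp
    ultimately show ?thesis by eventually_elim simp
  qed
  then obtain n0 where n0: "\<And>n. n \<ge> n0 \<Longrightarrow> d n \<le> 1 \<and> jump_energy j (\<lambda>x. u n x - v x) \<le> 1"
    unfolding eventually_sequentially by blast
  have sq: "ennreal ((a::real)\<^sup>2) \<le> 2 * ennreal (b\<^sup>2) + 2 * ennreal ((a - b)\<^sup>2)" for a b
  proof -
    have "a\<^sup>2 \<le> 2 * b\<^sup>2 + 2 * (a - b)\<^sup>2"
      using zero_le_power2[of "a - 2 * b"] by (simp add: power2_eq_square algebra_simps)
    then have "ennreal (a\<^sup>2) \<le> ennreal (2 * b\<^sup>2 + 2 * (a - b)\<^sup>2)" by (rule ennreal_leI)
    then show ?thesis by (simp add: ennreal_plus ennreal_mult)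
  qed
  \<comment> \<open>The two summands 2 absorb the approximation errors in energy and in norm, both
    at most 1 from \<open>n0\<close> on.\<close>
  define C where "C = 2 * jump_energy j v + 2 + 2 * ennreal \<Lambda> * (2 * ennreal (l2_inner \<mu> v v) + 2)"
  have "jump_energy j v < \<infinity>" using v by (rule En_self_tendsto(2))
  then have Cfin: "C < \<infinity>" unfolding C_def by (simp add: ennreal_mult_less_top)
  have bound: "ext_form \<mu> j (cut A k (u n)) \<le> C" if n: "n \<ge> n0" for n
  proof -
    have "jump_energy j (u n) \<le> (\<integral>\<^sup>+z. 2 * ennreal ((v (fst z) - v (snd z))\<^sup>2) +
        2 * ennreal (((u n (fst z) - v (fst z)) - (u n (snd z) - v (snd z)))\<^sup>2) \<partial>j)"
      unfolding jump_energy_def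
    proof (rule nn_integral_mono)
      fix z :: "'a \<times> 'a"
      show "ennreal ((u n (fst z) - u n (snd z))\<^sup>2) \<le> 2 * ennreal ((v (fst z) - v (snd z))\<^sup>2) +
          2 * ennreal (((u n (fst z) - v (fst z)) - (u n (snd z) - v (snd z)))\<^sup>2)"
        using sq[of "u n (fst z) - u n (snd z)" "v (fst z) - v (snd z)"] by (simp add: algebra_simps)
    qed
    also have "\<dots> = 2 * jump_energy j v + 2 * jump_energy j (\<lambda>x. u n x - v x)"
      unfolding jump_energy_def by (subst nn_integral_add) (simp_all add: nn_integral_cmult)
    also have "\<dots> \<le> 2 * jump_energy j v + 2 * 1"
      using n0[OF n] by (intro add_left_mono mult_left_mono) auto
    finally have 1: "jump_energy j (u n) \<le> 2 * jump_energy j v + 2" by simp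
    have "(\<integral>\<^sup>+x. ennreal ((u n x)\<^sup>2) \<partial>\<mu>)
        \<le> (\<integral>\<^sup>+x. 2 * ennreal ((v x)\<^sup>2) + 2 * ennreal ((u n x - v x)\<^sup>2) \<partial>\<mu>)"
      by (intro nn_integral_mono sq)
    also have "\<dots> = 2 * ennreal (l2_inner \<mu> v v) + 2 * ennreal (d n)"
      by (subst nn_integral_add) (simp_all add: nn_integral_cmult d_nn L2_nn_integral)
    also have "\<dots> \<le> 2 * ennreal (l2_inner \<mu> v v) + 2 * 1"
      using n0[OF n] by (intro add_left_mono mult_left_mono) auto
    finally have 2: "(\<integral>\<^sup>+x. ennreal ((u n x)\<^sup>2) \<partial>\<mu>) \<le> 2 * ennreal (l2_inner \<mu> v v) + 2" by simp
    have "ext_form \<mu> j (cut A k (u n)) = jump_energy j (cut A k (u n))"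
      using simple_ball_function_form_domain[OF cut_simple_ball_function[OF A u k]]
      by (simp add: ext_form_def)
    also have "\<dots> \<le> jump_energy j (u n) + 2 * ennreal \<Lambda> * (\<integral>\<^sup>+x. ennreal ((u n x)\<^sup>2) \<partial>\<mu>)"
      by (rule jump_energy_cut_le[OF A um k])
    also have "\<dots> \<le> C"
      unfolding C_def using 1 2 by (intro add_mono mult_left_mono) auto
    finally show ?thesis .
  qed
  show ?thesis
  proof (rule finite_form_approx[where g = "\<lambda>n. cut A k (u (n + n0))" and C = "enn2real C"])
    show "cut A k v \<in> L2 \<mu>" "cut A k (u (n + n0)) \<in> L2 \<mu>" for n
      using Ab k uL by (auto intro!: cut_L2)
    show "ext_form \<mu> j (cut A k (u (n + n0))) \<le> ennreal (enn2real C)" for n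
      using bound[of "n + n0"] Cfin by simp
    show "0 \<le> enn2real C" by simp
    have le: "ip (\<lambda>x. cut A k (u n) x - cut A k v x) (\<lambda>x. cut A k (u n) x - cut A k v x) \<le> d n" for n
      unfolding d_def
      using Ab k uL by (intro l2_inner_self_mono) (auto intro!: L2_diff cut_L2 cut_abs_diff_le)
    have "(\<lambda>n. ip (\<lambda>x. cut A k (u n) x - cut A k v x) (\<lambda>x. cut A k (u n) x - cut A k v x)) \<longlonglongrightarrow> 0"
      by (rule tendsto_sandwich[OF _ _ tendsto_const d0]) (auto simp: le l2_inner_nonneg)
    then show "(\<lambda>n. ip (\<lambda>x. cut A k (u (n + n0)) x - cut A k v x)
        (\<lambda>x. cut A k (u (n + n0)) x - cut A k v x)) \<longlonglongrightarrow> 0"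
      by (rule LIMSEQ_ignore_initial_segment)
  qed
qed

text \<open>Pairs inside \<open>A\<close> contribute nonnegatively, since cutting is monotone, and
  pairs outside contribute nothing. For x in \<open>A\<close> and y outside, the integrand is (v x -
  v y) times the cut at x; where the cut is positive, v x > k \<ge> 0 and v y \<le> 1, so the loss
  is at most the cut itself. Integrability is asked of \<Lambda> times the cut, which leaves the
  case \<Lambda> = 0 unrestricted: there the cut need not be integrable.\<close>

lemma jform_cut_ge:
  assumes A: "jump_rate A \<Lambda>" and v: "finite_form v" and k: "0 \<le> k"
    and out: "AE x in \<mu>. x \<notin> A \<longrightarrow> v x \<le> 1"
    and int: "integrable \<mu> (\<lambda>x. \<Lambda> * cut A k v x)"
  shows "- 2 * (\<integral>x. \<Lambda> * cut A k v x \<partial>\<mu>) \<le> jform v (cut A k v)"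
proof -
  have [measurable]: "v \<in> borel_measurable borel" using v by (rule finite_form_measurable)
  note [measurable] = jump_rateD(1)[OF A]
  let ?g = "cut A k v"
  let ?F = "\<lambda>z. ?g (fst z) * indicator (A \<times> - A) z"
  let ?G = "\<lambda>z. ?g (snd z) * indicator (A \<times> - A) (snd z, fst z)"
  let ?I = "\<integral>x. \<Lambda> * cut A k v x \<partial>\<mu>"
  have I: "ennreal \<Lambda> * (\<integral>\<^sup>+x. ennreal (?g x) \<partial>\<mu>) = ennreal ?I"
  proof -
    have "ennreal \<Lambda> * (\<integral>\<^sup>+x. ennreal (?g x) \<partial>\<mu>) = (\<integral>\<^sup>+x. ennreal (\<Lambda> * ?g x) \<partial>\<mu>)"
      using jump_rateD(2)[OF A] by (subst nn_integral_cmult[symmetric]) (simp_all add: ennreal_mult cut_nonneg)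
    also have "\<dots> = ennreal ?I"
      using int jump_rateD(2)[OF A] by (intro nn_integral_eq_integral) (auto simp: cut_nonneg)
    finally show ?thesis .
  qed
  have F: "(\<integral>\<^sup>+z. ennreal (?F z) \<partial>j) \<le> ennreal ?I" "(\<integral>\<^sup>+z. ennreal (?G z) \<partial>j) \<le> ennreal ?I"
    using jump_rateD(4)[OF A, of "\<lambda>x. ennreal (?g x)"] jump_rateD(5)[OF A, of "\<lambda>x. ennreal (?g x)"]
    unfolding I by (simp_all add: ennreal_mult cut_nonneg ennreal_indicator)
  have int_F: "integrable j ?F" "integrable j ?G"
    using F by (auto intro!: integrableI_nonneg simp: cut_nonneg order.strict_trans1)
  have I0: "0 \<le> ?I" using jump_rateD(2)[OF A] by (intro integral_nonneg_AE) (simp add: cut_nonneg)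
  have "ennreal (\<integral>z. ?F z \<partial>j) \<le> ennreal ?I" "ennreal (\<integral>z. ?G z \<partial>j) \<le> ennreal ?I"
    using F int_F by (simp_all add: nn_integral_eq_integral[symmetric] cut_nonneg)
  then have FG: "(\<integral>z. ?F z \<partial>j) \<le> ?I" "(\<integral>z. ?G z \<partial>j) \<le> ?I"
    using I0 by simp_all
  have "(\<integral>z. - (?F z + ?G z) \<partial>j) \<le> jform v ?g"
    unfolding jform_def
  proof (rule integral_mono_AE)
    show "integrable j (\<lambda>z. - (?F z + ?G z))" using int_F by simp
    show "integrable j (\<lambda>z. (v (fst z) - v (snd z)) * (?g (fst z) - ?g (snd z)))"
      using v finite_form_cut[OF A v k] by (rule En_tendsto_jform(2))
    show "AE z in j. - (?F z + ?G z) \<le> (v (fst z) - v (snd z)) * (?g (fst z) - ?g (snd z))"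
      using AE_j_fst[OF out] AE_j_snd[OF out]
    proof eventually_elim
      case (elim z)
      obtain x y where z: "z = (x, y)" by force
      have mono: "0 \<le> (v x - v y) * (max 0 (v x - k) - max 0 (v y - k))" for x y
        by (cases "v x \<le> v y") (auto intro!: mult_nonneg_nonneg mult_nonpos_nonpos)
      have cross: "- max 0 (v x - k) \<le> (v x - v y) * max 0 (v x - k)" if "v y \<le> 1" for x y
      proof (cases "v x \<le> k")
        case False
        then have "(- 1) * (v x - k) \<le> (v x - v y) * (v x - k)"
          using that k by (intro mult_right_mono) auto
        then show ?thesis using False by (simp add: max_def)
      qed simp
      show ?case
        using elim mono[of x y] cross[of y x] cross[of x y] unfolding z
        by (cases "x \<in> A"; cases "y \<in> A") (simp_all add: cut_def algebra_simps)
    qed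
  qed
  moreover have "(\<integral>z. - (?F z + ?G z) \<partial>j) = - ((\<integral>z. ?F z \<partial>j) + (\<integral>z. ?G z \<partial>j))"
    using int_F by simp
  ultimately show ?thesis using FG by simp
qed

section \<open>Evolution of the excess over a moving level\<close>

lemma norm_P_step_le:
  assumes "s > 0" "h > 0" "f \<in> L2 \<mu>"
  shows "ip (\<lambda>x. P h (P s f) x - P s f x) (\<lambda>x. P h (P s f) x - P s f x)
    \<le> ip (\<lambda>x. P h f x - f x) (\<lambda>x. P h f x - f x)"
proof -
  have "AE x in \<mu>. P h (P s f) x - P s f x = P s (\<lambda>x. P h f x - f x) x"
    using P_semigroup[OF assms(2,1,3)] P_semigroup[OF assms(1,2,3)]
      P_diff[OF assms(1) P_L2[OF assms(2,3)] assms(3)]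
    by eventually_elim (simp add: add.commute)
  then have "ip (\<lambda>x. P h (P s f) x - P s f x) (\<lambda>x. P h (P s f) x - P s f x)
      = ip (P s (\<lambda>x. P h f x - f x)) (P s (\<lambda>x. P h f x - f x))"
    using assms by (intro l2_inner_cong_AE) (auto intro!: P_L2 L2_diff)
  also have "\<dots> \<le> ip (\<lambda>x. P h f x - f x) (\<lambda>x. P h f x - f x)"
    using assms by (intro P_contraction L2_diff P_L2)
  finally show ?thesis .
qed

text \<open>The affine level serves three purposes: c = b = 0 gives positivity, c = 0 and b = 1 the
  sub-Markov property, c = 2 \<Lambda> and b = 0 the bound on entering \<open>A\<close>.\<close>

definition excess :: "'a set \<Rightarrow> real \<Rightarrow> real \<Rightarrow> ('a \<Rightarrow> real) \<Rightarrow> real \<Rightarrow> real" where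
  "excess A c b f t = ip (cut A (c * t + b) (P t f)) (cut A (c * t + b) (P t f))"

text \<open>A Chebyshev argument: where the cut is positive, w \<ge> c t, so c times the cut is at
  most w^2 / t and c^2 is at most w^2 / t^2. Thus the terms linear in the cut are integrable even if
  \<mu> is infinite.\<close>

lemma excess_level_integrable:
  assumes A: "A \<in> sets borel" and w: "w \<in> L2 \<mu>" and c: "0 \<le> c" and b: "0 \<le> b" and t: "t > 0"
  shows "integrable \<mu> (\<lambda>x. c * cut A (c * t + b) w x)"
    and "integrable \<mu> (\<lambda>x. if 0 < cut A (c * t + b) w x then c\<^sup>2 else 0)"
    and "(\<integral>x. (if 0 < cut A (c * t + b) w x then c\<^sup>2 else 0) \<partial>\<mu>) \<le> ip w w / t\<^sup>2"
proof -
  note [measurable] = A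
  have [measurable]: "w \<in> borel_measurable borel" using L2_measurable[OF w] by simp
  let ?g = "cut A (c * t + b) w"
  have ct: "0 \<le> c * t" using c t by simp
  have pos: "c * t \<le> w x \<and> 0 < w x \<and> ?g x \<le> w x" if "0 < ?g x" for x
    using that ct b by (cases "x \<in> A") (auto simp: cut_def max_def split: if_splits)
  have 1: "\<bar>c * ?g x\<bar> \<le> \<bar>(w x)\<^sup>2 / t\<bar>" for x
  proof (cases "0 < ?g x")
    case True
    have "(c * t) * ?g x \<le> w x * w x"
      using pos[OF True] True ct by (intro mult_mono) auto
    then have "c * ?g x \<le> (w x)\<^sup>2 / t" using t by (simp add: field_simps power2_eq_square)
    then show ?thesis using c True t by (simp add: abs_mult)
  next
    case False
    then have "?g x = 0" using cut_nonneg[of A "c * t + b" w x] by linarith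
    then show ?thesis by simp
  qed
  have 2: "(if 0 < ?g x then c\<^sup>2 else 0) \<le> (w x)\<^sup>2 / t\<^sup>2" for x
  proof (cases "0 < ?g x")
    case True
    have "(c * t)\<^sup>2 \<le> (w x)\<^sup>2" using pos[OF True] ct by (intro power_mono) auto
    then show ?thesis using t True by (simp add: field_simps power_mult_distrib)
  qed simp
  have W: "integrable \<mu> (\<lambda>x. (w x)\<^sup>2 / t)" "integrable \<mu> (\<lambda>x. (w x)\<^sup>2 / t\<^sup>2)"
    using L2_square_integrable[OF w] by simp_all
  show "integrable \<mu> (\<lambda>x. c * ?g x)"
    using 1 by (intro Bochner_Integration.integrable_bound[OF W(1)]) simp_all
  show 3: "integrable \<mu> (\<lambda>x. if 0 < ?g x then c\<^sup>2 else 0)"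
  proof (rule Bochner_Integration.integrable_bound[OF W(2)])
    show "AE x in \<mu>. norm (if 0 < ?g x then c\<^sup>2 else 0) \<le> norm ((w x)\<^sup>2 / t\<^sup>2)"
      using 2 by (intro AE_I2) (smt (verit) real_norm_def zero_le_power2)
  qed simp
  have "(\<integral>x. (if 0 < ?g x then c\<^sup>2 else 0) \<partial>\<mu>) \<le> (\<integral>x. (w x)\<^sup>2 / t\<^sup>2 \<partial>\<mu>)"
    using 2 3 W(2) by (intro integral_mono) auto
  then show "(\<integral>x. (if 0 < ?g x then c\<^sup>2 else 0) \<partial>\<mu>) \<le> ip w w / t\<^sup>2"
    by (simp add: l2_inner_def power2_eq_square)
qed

lemma excess_step:
  fixes f :: "'a \<Rightarrow> real" and t c b :: real
  assumes A: "A \<in> sets borel" and f: "f \<in> L2 \<mu>" and c: "0 \<le> c" and b: "0 \<le> b"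
    and t: "t > 0" and h: "h > 0"
  defines "w \<equiv> P t f" and "g \<equiv> cut A (c * t + b) (P t f)"
  defines "\<delta> \<equiv> \<lambda>x. P h w x - w x"
  shows "excess A c b f (t + h) \<le> excess A c b f t + 2 * ip g \<delta> - 2 * h * (\<integral>x. c * g x \<partial>\<mu>)
    + 2 * ip \<delta> \<delta> + 2 * h\<^sup>2 * (\<integral>x. (if 0 < g x then c\<^sup>2 else 0) \<partial>\<mu>)"
proof -
  have ct: "0 \<le> c * t + b" "0 \<le> c * (t + h) + b" using c b t h by simp_all
  have w: "w \<in> L2 \<mu>" unfolding w_def using t f by (rule P_L2)
  have hw: "P h w \<in> L2 \<mu>" using h w by (rule P_L2)
  have \<delta>: "\<delta> \<in> L2 \<mu>" unfolding \<delta>_def using hw w by (rule L2_diff)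
  have g: "g \<in> L2 \<mu>" unfolding g_def using A w ct by (intro cut_L2) (auto simp: w_def)
  define g' where "g' = cut A (c * (t + h) + b) (P h w)"
  have g': "g' \<in> L2 \<mu>" unfolding g'_def using A hw ct by (intro cut_L2) auto
  have "AE x in \<mu>. P (t + h) f x = P h w x"
    using P_semigroup[OF h t f] by (simp add: w_def add.commute)
  then have "AE x in \<mu>. cut A (c * (t + h) + b) (P (t + h) f) x = g' x"
    by eventually_elim (simp add: g'_def cut_def)
  moreover have "cut A (c * (t + h) + b) (P (t + h) f) \<in> L2 \<mu>"
    using A t h f ct by (intro cut_L2 P_L2) auto
  ultimately have "excess A c b f (t + h) = ip g' g'"
    unfolding excess_def using g' by (intro l2_inner_cong_AE)
  also have "\<dots> \<le> (\<integral>x. g x * g x + 2 * (g x * \<delta> x) - 2 * h * (c * g x) + 2 * (\<delta> x * \<delta> x)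
      + 2 * h\<^sup>2 * (if 0 < g x then c\<^sup>2 else 0) \<partial>\<mu>)"
    unfolding l2_inner_def
  proof (rule integral_mono)
    show "integrable \<mu> (\<lambda>x. g' x * g' x)" using g' g' by (rule L2_mult_integrable)
    show "integrable \<mu> (\<lambda>x. g x * g x + 2 * (g x * \<delta> x) - 2 * h * (c * g x) + 2 * (\<delta> x * \<delta> x)
      + 2 * h\<^sup>2 * (if 0 < g x then c\<^sup>2 else 0))"
      using g \<delta> excess_level_integrable(1,2)[OF A w c b t]
      by (intro Bochner_Integration.integrable_add Bochner_Integration.integrable_diff
          integrable_mult_right L2_mult_integrable) (simp_all add: g_def w_def)
    fix x
    show "g' x * g' x \<le> g x * g x + 2 * (g x * \<delta> x) - 2 * h * (c * g x) + 2 * (\<delta> x * \<delta> x)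
      + 2 * h\<^sup>2 * (if 0 < g x then c\<^sup>2 else 0)"
    proof (cases "x \<in> A")
      case True
      define y where "y = w x - (c * t + b)"
      have "g x = max 0 y" "g' x = max 0 (y + \<delta> x - c * h)" "0 < g x \<longleftrightarrow> 0 < y"
        using True by (auto simp: g_def g'_def cut_def w_def \<delta>_def y_def algebra_simps)
      then show ?thesis
        using square_max_step[of "c * h" y "\<delta> x"] c h
        by (auto simp: power2_eq_square algebra_simps)
    next
      case False
      then have "g x = 0" "g' x = 0" by (simp_all add: g_def g'_def cut_def)
      then show ?thesis by simp
    qed
  qed
  also have "\<dots> = ip g g + 2 * ip g \<delta> - 2 * h * (\<integral>x. c * g x \<partial>\<mu>) + 2 * ip \<delta> \<delta>
      + 2 * h\<^sup>2 * (\<integral>x. (if 0 < g x then c\<^sup>2 else 0) \<partial>\<mu>)"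
  proof -
    have i: "integrable \<mu> (\<lambda>x. g x * g x)" "integrable \<mu> (\<lambda>x. 2 * (g x * \<delta> x))"
      "integrable \<mu> (\<lambda>x. 2 * (\<delta> x * \<delta> x))" "integrable \<mu> (\<lambda>x. 2 * h * (c * g x))"
      "integrable \<mu> (\<lambda>x. 2 * h\<^sup>2 * (if 0 < g x then c\<^sup>2 else 0))"
      using g \<delta> excess_level_integrable(1,2)[OF A w c b t]
      by (intro integrable_mult_right L2_mult_integrable; simp add: g_def w_def)+
    show ?thesis unfolding l2_inner_def
      by (simp only: Bochner_Integration.integral_add Bochner_Integration.integral_diff
          Bochner_Integration.integrable_add Bochner_Integration.integrable_diff i integral_mult_right_zero)
  qed
  also have "ip g g = excess A c b f t" by (simp add: excess_def g_def)
  finally show ?thesis .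
qed

text \<open>The excess starts at 0, has nonpositive right derivative and no upward jumps, so it
  vanishes. At time t the upper right derivative is at most -2 times \<open>jform w g\<close> minus
  2 c times the integral of g, where w is \<open>P t f\<close> and g its cut.\<close>

lemma comparison:
  assumes A: "jump_rate A \<Lambda>" and f: "f \<in> L2 \<mu>" and b: "0 \<le> b"
    and init: "AE x in \<mu>. x \<in> A \<longrightarrow> f x \<le> b"
    and out: "\<And>t. t > 0 \<Longrightarrow> AE x in \<mu>. x \<notin> A \<longrightarrow> P t f x \<le> 1"
    and T: "T > 0"
  shows "AE x in \<mu>. x \<in> A \<longrightarrow> P T f x \<le> 2 * \<Lambda> * T + b"
proof -
  \<comment> \<open>With this slope the rise of the level compensates exactly the loss allowed by
    \<open>jform_cut_ge\<close>.\<close>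
  define c where "c = 2 * \<Lambda>"
  have c: "0 \<le> c" using jump_rateD(2)[OF A] by (simp add: c_def)
  have Ab: "A \<in> sets borel" using jump_rateD(1)[OF A] .
  define N where "N = excess A c b f"
  define q where "q h = ip (\<lambda>x. P h f x - f x) (\<lambda>x. P h f x - f x)" for h
  have q0: "(q \<longlongrightarrow> 0) (at_right 0)" unfolding q_def by (rule P_continuous[OF f])
  have f0: "0 \<le> ip f f" by (rule l2_inner_nonneg)
  have right: "\<forall>\<^sub>F h in at_right 0. N (t + h) \<le> N t + \<epsilon> * h" if t: "t > 0" and \<epsilon>: "\<epsilon> > 0" for t \<epsilon>
  proof -
    define w where "w = P t f"
    define g where "g = cut A (c * t + b) (P t f)"
    define D where "D = (\<integral>x. (if 0 < g x then c\<^sup>2 else 0) \<partial>\<mu>)"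
    define m where "m = (\<integral>x. c * g x \<partial>\<mu>)"
    \<comment> \<open>By \<open>excess_step\<close> this bounds the difference quotient of
      \<open>N\<close> at t: the linear term (g, P_h w - w) equals -h times
      \<open>En h w g\<close>.\<close>
    define e where "e h = - 2 * En h w g - 2 * m + 2 * (ip (\<lambda>x. P h w x - w x) (\<lambda>x. P h w x - w x) / h)
      + 2 * h * D" for h
    have ct: "0 \<le> c * t + b" using c t b by simp
    have w: "finite_form w" unfolding w_def using t f by (rule finite_form_P)
    have g: "finite_form g" unfolding g_def using finite_form_cut[OF A w ct] by (simp add: w_def)
    note wL = w[THEN finite_form_L2] and gL = g[THEN finite_form_L2]
    have int: "integrable \<mu> (\<lambda>x. c * g x)"
      using excess_level_integrable(1)[OF Ab wL c b t] by (simp add: w_def g_def)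
    have "- 2 * (\<integral>x. \<Lambda> * g x \<partial>\<mu>) \<le> jform w g"
      using jform_cut_ge[OF A w ct] out[OF t] int unfolding w_def g_def c_def
      by (auto simp: mult.assoc)
    moreover have "2 * (\<integral>x. \<Lambda> * g x \<partial>\<mu>) = m"
      unfolding m_def c_def by (simp add: mult.assoc flip: integral_mult_right_zero)
    ultimately have "- 2 * jform w g - 2 * m \<le> 0" by simp
    moreover have "(e \<longlongrightarrow> - 2 * jform w g - 2 * m + 2 * 0 + 2 * 0 * D) (at_right 0)"
      unfolding e_def
      by (intro tendsto_intros En_tendsto_jform w g norm_P_diff_little_o)
    ultimately have "\<forall>\<^sub>F h in at_right 0. e h < \<epsilon>"
      using \<epsilon> by (intro order_tendstoD(2)[where y = "- 2 * jform w g - 2 * m + 2 * 0 + 2 * 0 * D"]) auto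
    then show ?thesis
      using eventually_at_right_less[of "0::real"]
    proof eventually_elim
      case (elim h)
      have "ip g (\<lambda>x. P h w x - w x) = - h * En h w g"
        using elim(2) wL gL by (simp add: En_def l2_inner_diff_left P_L2 l2_inner_commute[of \<mu> g])
      then have "N (t + h) \<le> N t + h * e h"
        using excess_step[OF Ab f c b t elim(2)] elim(2)
        by (simp add: N_def e_def D_def m_def w_def g_def algebra_simps power2_eq_square)
      also have "h * e h \<le> \<epsilon> * h" using elim by simp
      finally show ?case by simp
    qed
  qed
  have left: "\<forall>\<^sub>F h in at_right 0. N t \<le> N (t - h) + \<epsilon>" if t: "t > 0" and \<epsilon>: "\<epsilon> > 0" for t \<epsilon>
  proof -
    \<comment> \<open>The parameter of Young's inequality for the linear term of
      \<open>excess_step\<close>. The part in g costs at most \<epsilon> / 2, and the other part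
      vanishes with h by strong continuity. The summand 1 covers the case that f has norm 0.\<close>
    define \<eta> where "\<eta> = \<epsilon> / (2 * (ip f f + 1))"
    have \<eta>: "\<eta> > 0" using \<epsilon> f0 by (simp add: \<eta>_def)
    have \<eta>f: "\<eta> * ip f f \<le> \<epsilon> / 2"
    proof -
      have "\<eta> * ip f f \<le> \<eta> * (ip f f + 1)" using \<eta> by simp
      also have "\<dots> = \<epsilon> / 2" using f0 by (simp add: \<eta>_def field_simps)
      finally show ?thesis .
    qed
    have "((\<lambda>h. q h / \<eta> + 2 * q h + 2 * h\<^sup>2 * (4 * ip f f / t\<^sup>2)) \<longlongrightarrow>
        0 / \<eta> + 2 * 0 + 2 * 0\<^sup>2 * (4 * ip f f / t\<^sup>2)) (at_right 0)"
      using \<eta> by (intro tendsto_intros q0) auto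
    then have "\<forall>\<^sub>F h in at_right 0. q h / \<eta> + 2 * q h + 2 * h\<^sup>2 * (4 * ip f f / t\<^sup>2) < \<epsilon> / 2"
      using \<epsilon> by (intro order_tendstoD(2)) auto
    \<comment> \<open>This keeps the earlier time s = t - h above t / 2, so that the bound with 1 /
      s^2 is uniform in h.\<close>
    moreover have "\<forall>\<^sub>F h in at_right 0. h < t / 2"
      using t by (intro order_tendstoD(2)[OF tendsto_ident_at]) simp
    ultimately show ?thesis
      using eventually_at_right_less[of "0::real"]
    proof eventually_elim
      case (elim h)
      define s where "s = t - h"
      have s: "s > 0" "t / 2 \<le> s" "s + h = t" using elim t by (auto simp: s_def)
      define w where "w = P s f"
      define g where "g = cut A (c * s + b) (P s f)"
      define d where "d x = P h w x - w x" for x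
      have w: "w \<in> L2 \<mu>" unfolding w_def using s(1) f by (rule P_L2)
      have d: "d \<in> L2 \<mu>" unfolding d_def[abs_def] using w elim(3) by (intro L2_diff P_L2)
      have cs: "0 \<le> c * s + b" using c s b by simp
      have g: "g \<in> L2 \<mu>" unfolding g_def using Ab w cs by (intro cut_L2) (auto simp: w_def)
      \<comment> \<open>The increment over h at time s is dominated by the one at time 0, a bound
        that does not depend on the moving time s.\<close>
      have dq: "ip d d \<le> q h" unfolding d_def[abs_def] q_def w_def using s(1) elim(3) f by (rule norm_P_step_le)
      have ww: "ip w w \<le> ip f f" unfolding w_def using s(1) f by (rule P_contraction)
      have "ip g g \<le> ip w w"
        using w g by (rule l2_inner_self_mono) (auto simp: g_def w_def cs intro!: cut_abs_le)
      with ww have gg: "ip g g \<le> ip f f" by simp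
      have "2 * ip g d \<le> \<eta> * ip g g + ip d d / \<eta>" by (rule l2_inner_young[OF g d \<eta>])
      also have "\<dots> \<le> \<eta> * ip f f + q h / \<eta>"
        using gg dq \<eta> by (intro add_mono mult_left_mono divide_right_mono) auto
      finally have 1: "2 * ip g d \<le> \<epsilon> / 2 + q h / \<eta>" using \<eta>f by simp
      have "0 \<le> (\<integral>x. c * g x \<partial>\<mu>)" using c by (intro integral_nonneg_AE) (simp add: g_def cut_nonneg)
      then have 2: "0 \<le> h * (\<integral>x. c * g x \<partial>\<mu>)" using elim(3) by simp
      have "(\<integral>x. (if 0 < g x then c\<^sup>2 else 0) \<partial>\<mu>) \<le> ip w w / s\<^sup>2"
        using excess_level_integrable(3)[OF Ab w c b s(1)] by (simp add: g_def w_def)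
      also have "\<dots> \<le> ip f f / (t / 2)\<^sup>2"
        using ww s t f0 by (intro frac_le power_mono) auto
      finally have 3: "2 * h\<^sup>2 * (\<integral>x. (if 0 < g x then c\<^sup>2 else 0) \<partial>\<mu>) \<le> 2 * h\<^sup>2 * (4 * ip f f / t\<^sup>2)"
        by (intro mult_left_mono) (simp_all add: power2_eq_square field_simps)
      have "N (s + h) \<le> N s + 2 * ip g d - 2 * h * (\<integral>x. c * g x \<partial>\<mu>) + 2 * ip d d
          + 2 * h\<^sup>2 * (\<integral>x. (if 0 < g x then c\<^sup>2 else 0) \<partial>\<mu>)"
        using excess_step[OF Ab f c b s(1) elim(3)] by (simp add: N_def w_def g_def d_def[abs_def])
      then have "N t \<le> N s + \<epsilon>" using 1 2 3 dq elim(1) unfolding s(3) by linarith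
      then show ?case by (simp add: s_def)
    qed
  qed
  \<comment> \<open>Since f \<le> b on \<open>A\<close> and the level is at least b, the excess at
    time a is bounded pointwise by the increment of the semigroup from f, which tends to 0 in
    \<open>L2\<close>.\<close>
  have N_init: "N a \<le> q a" if a: "a > 0" for a
  proof -
    have ca: "0 \<le> c * a" using c a by simp
    have "N a = ip (cut A (c * a + b) (P a f)) (cut A (c * a + b) (P a f))"
      by (simp add: N_def excess_def)
    also have "\<dots> \<le> q a"
      unfolding q_def l2_inner_def
    proof (rule integral_mono_AE)
      show "integrable \<mu> (\<lambda>x. cut A (c * a + b) (P a f) x * cut A (c * a + b) (P a f) x)"
        using a f Ab ca b by (intro L2_mult_integrable cut_L2 P_L2) auto
      show "integrable \<mu> (\<lambda>x. (P a f x - f x) * (P a f x - f x))"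
        using a f by (intro L2_mult_integrable L2_diff P_L2)
      show "AE x in \<mu>. cut A (c * a + b) (P a f) x * cut A (c * a + b) (P a f) x
          \<le> (P a f x - f x) * (P a f x - f x)"
        using init
      proof eventually_elim
        case (elim x)
        then have "\<bar>cut A (c * a + b) (P a f) x\<bar> \<le> \<bar>P a f x - f x\<bar>"
          using ca by (auto simp: cut_def indicator_def)
        then show ?case by (simp add: abs_le_square_iff power2_eq_square)
      qed
    qed
    finally show ?thesis .
  qed
  have "\<forall>\<^sub>F a in at_right 0. N T \<le> q a"
  proof -
    have "\<forall>\<^sub>F a in at_right 0. a < T" using T by (intro order_tendstoD(2)[OF tendsto_ident_at]) simp
    then show ?thesis
      using eventually_at_right_less[of "0::real"]
    proof eventually_elim
      case (elim a)
      have "N T \<le> N a"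
        using nonincreasing_if_right_Dini_nonpos[of N a T, OF right left] elim by simp
      with N_init[of a] elim show ?case by simp
    qed
  qed
  then have "N T \<le> 0" by (intro tendsto_lowerbound[OF q0]) auto
  let ?G = "cut A (c * T + b) (P T f)"
  have G: "?G \<in> L2 \<mu>" using c T b Ab f by (intro cut_L2 P_L2) auto
  have "(\<integral>x. ?G x * ?G x \<partial>\<mu>) = 0"
    using \<open>N T \<le> 0\<close> l2_inner_nonneg[of \<mu> ?G] unfolding N_def excess_def l2_inner_def
    by (rule antisym)
  then have "AE x in \<mu>. ?G x * ?G x = 0"
    using L2_mult_integrable[OF G G] by (subst (asm) integral_nonneg_eq_0_iff_AE) auto
  then show ?thesis
    by eventually_elim (auto simp: cut_def c_def max_def split: if_splits)
qed

section \<open>Markov property and entrance bound\<close>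

lemma P_nonneg:
  assumes t: "t > 0" and f: "f \<in> L2 \<mu>" and "AE x in \<mu>. 0 \<le> f x"
  shows "AE x in \<mu>. 0 \<le> P t f x"
proof -
  have "AE x in \<mu>. x \<in> UNIV \<longrightarrow> P t (\<lambda>x. - f x) x \<le> 2 * 0 * t + 0"
    using assms by (intro comparison[OF jump_rate_UNIV] L2_uminus) auto
  then show ?thesis using P_uminus[OF t f] by eventually_elim simp
qed

lemma P_le_one:
  assumes "t > 0" "f \<in> L2 \<mu>" "AE x in \<mu>. f x \<le> 1"
  shows "AE x in \<mu>. P t f x \<le> 1"
proof -
  have "AE x in \<mu>. x \<in> UNIV \<longrightarrow> P t f x \<le> 2 * 0 * t + 1"
    using assms by (intro comparison[OF jump_rate_UNIV]) auto
  then show ?thesis by simp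
qed

text \<open>Comparison is used twice: on the whole space it yields \<open>P s f\<close> \<le> 1 at
  all times, which is the outer bound that comparison on \<open>A\<close> requires.\<close>

lemma P_entrance_le:
  assumes "jump_rate A \<Lambda>" "t > 0" "f \<in> L2 \<mu>" "AE x in \<mu>. f x \<le> indicator (- A) x"
  shows "AE x in \<mu>. x \<in> A \<longrightarrow> P t f x \<le> 2 * \<Lambda> * t"
proof -
  have le1: "AE x in \<mu>. f x \<le> 1"
    using assms(4) by eventually_elim (rule order_trans, auto simp: indicator_def)
  have le0: "AE x in \<mu>. x \<in> A \<longrightarrow> f x \<le> 0"
    using assms(4) by eventually_elim auto
  have "AE x in \<mu>. x \<in> A \<longrightarrow> P t f x \<le> 2 * \<Lambda> * t + 0"
  proof (rule comparison[OF assms(1,3) _ le0 _ assms(2)])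
    fix s :: real assume "s > 0"
    then have "AE x in \<mu>. P s f x \<le> 1" using assms(3) le1 by (rule P_le_one)
    then show "AE x in \<mu>. x \<notin> A \<longrightarrow> P s f x \<le> 1" by eventually_elim simp
  qed simp
  then show ?thesis by simp
qed

end

section \<open>From rectangles to almost everywhere bounds\<close>

text \<open>The difference of the two measures is a premeasure on the semiring; its Caratheodory extension
  has to make up the difference on the whole sigma-algebra.\<close>

lemma emeasure_le_if_le_on_semiring:
  assumes S: "semiring_of_sets \<Omega> S" "\<Omega> \<in> S"
    and sM: "sets M = sigma_sets \<Omega> S" and sN: "sets N = sigma_sets \<Omega> S"
    and fin: "emeasure N \<Omega> < \<infinity>"
    and le: "\<And>A. A \<in> S \<Longrightarrow> emeasure M A \<le> emeasure N A"
    and A: "A \<in> sets M"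
  shows "emeasure M A \<le> emeasure N A"
proof -
  interpret semiring_of_sets \<Omega> S by fact
  have SM: "B \<in> sets M" "B \<in> sets N" if "B \<in> S" for B
    using that by (auto simp: sM sN)
  have sub: "B \<subseteq> \<Omega>" if "B \<in> sigma_sets \<Omega> S" for B
    using that sigma_sets_into_sp[OF space_closed] by blast
  have \<Omega>M: "\<Omega> \<in> sets M" "\<Omega> \<in> sets N" using SM S(2) by auto
  have finN: "emeasure N B < \<infinity>" if "B \<in> sigma_sets \<Omega> S" for B
    using emeasure_mono[OF sub[OF that] \<Omega>M(2)] fin by (simp add: order.strict_trans1)
  have finM: "emeasure M B < \<infinity>" if "B \<in> sigma_sets \<Omega> S" for B
    using emeasure_mono[OF sub[OF that] \<Omega>M(1)] le[OF S(2)] fin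
    by (meson order.strict_trans1)
  define f where "f B = emeasure N B - emeasure M B" for B
  have "positive S f" by (simp add: positive_def f_def)
  moreover have "countably_additive S f"
    unfolding countably_additive_def
  proof (intro allI impI)
    fix B :: "nat \<Rightarrow> 'a set"
    assume B: "range B \<subseteq> S" "disjoint_family B" "(\<Union>i. B i) \<in> S"
    have M: "(\<Sum>i. emeasure M (B i)) = emeasure M (\<Union>i. B i)"
      using B SM by (intro suminf_emeasure) auto
    have N: "(\<Sum>i. emeasure N (B i)) = emeasure N (\<Union>i. B i)"
      using B SM by (intro suminf_emeasure) auto
    have U: "(\<Union>i. B i) \<in> sigma_sets \<Omega> S" using B(3) by auto
    have "(\<Sum>i. f (B i)) = (\<Sum>i. emeasure N (B i)) - (\<Sum>i. emeasure M (B i))"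
      unfolding f_def
      using finN[OF U] finM[OF U] B(1) by (intro ennreal_suminf_minus le) (auto simp: M N)
    then show "(\<Sum>i. f (B i)) = f (\<Union>i. B i)" by (simp add: M N f_def)
  qed
  ultimately obtain \<nu> where \<nu>: "\<And>B. B \<in> S \<Longrightarrow> \<nu> B = f B" "measure_space \<Omega> (sigma_sets \<Omega> S) \<nu>"
    using caratheodory[of f] by blast
  define K where "K = measure_of \<Omega> (sigma_sets \<Omega> S) \<nu>"
  have sK: "sets K = sigma_sets \<Omega> S"
    unfolding K_def using \<nu>(2) by (simp add: measure_space_def sigma_algebra.sets_measure_of_eq)
  have eK: "emeasure K B = \<nu> B" if "B \<in> sigma_sets \<Omega> S" for B
    unfolding K_def using \<nu>(2) that
    by (intro emeasure_measure_of_sigma) (auto simp: measure_space_def)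
  have "Int_stable S" by (auto simp: Int_stable_def)
  \<comment> \<open>The inequality between the measures is not stable under complements. The
    identity with the difference measure \<open>K\<close> is, so the induction is over the
    identity.\<close>
  from this space_closed A[unfolded sM] have "emeasure M A + emeasure K A = emeasure N A"
  proof (induction rule: sigma_sets_induct_disjoint)
    case (basic A)
    then have "A \<in> sigma_sets \<Omega> S" by auto
    then show ?case
      using le[OF basic] \<nu>(1)[OF basic] finM[of A] eK[of A] by (simp add: f_def diff_add_cancel_ennreal add.commute)
  next
    case (compl A)
    have N\<Omega>: "emeasure M \<Omega> + emeasure K \<Omega> = emeasure N \<Omega>"
      using le[OF S(2)] \<nu>(1)[OF S(2)] eK[of \<Omega>] S(2) by (simp add: f_def diff_add_cancel_ennreal add.commute sigma_sets.Basic)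
    have split: "emeasure L \<Omega> = emeasure L A + emeasure L (\<Omega> - A)" if "sets L = sigma_sets \<Omega> S" for L
    proof -
      have "A \<union> (\<Omega> - A) = \<Omega>" using sub[OF compl(1)] by blast
      moreover have "\<Omega> - A \<in> sets L" using that compl(1) by (simp add: sigma_sets.Compl)
      ultimately show ?thesis using that compl(1) plus_emeasure[of A L "\<Omega> - A"] by simp
    qed
    have "emeasure N A + (emeasure M (\<Omega> - A) + emeasure K (\<Omega> - A))
        = (emeasure M A + emeasure M (\<Omega> - A)) + (emeasure K A + emeasure K (\<Omega> - A))"
      unfolding compl(2)[symmetric] by (simp add: ac_simps)
    also have "\<dots> = emeasure N A + emeasure N (\<Omega> - A)"
      using N\<Omega> split[OF sM] split[OF sK] split[OF sN] by simp
    finally show ?case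
      using finN[OF compl(1)] by (auto simp: ennreal_add_left_cancel)
  next
    case (union A)
    have "emeasure L (\<Union>i. A i) = (\<Sum>i. emeasure L (A i))" if "sets L = sigma_sets \<Omega> S" for L
      using that union by (intro suminf_emeasure[symmetric]) auto
    then show ?case using sM sN sK union(3) by (simp add: suminf_add)
  qed simp
  then show ?thesis by (metis le_iff_add)
qed

lemma semiring_of_rectangles:
  "semiring_of_sets (space M \<times> space N) {A \<times> B | A B. A \<in> sets M \<and> B \<in> sets N}"
proof
  show "{A \<times> B | A B. A \<in> sets M \<and> B \<in> sets N} \<subseteq> Pow (space M \<times> space N)"
    by (auto dest: sets.sets_into_space)
  show "{} \<in> {A \<times> B | A B. A \<in> sets M \<and> B \<in> sets N}" by blast
next
  fix a b
  assume "a \<in> {A \<times> B | A B. A \<in> sets M \<and> B \<in> sets N}" "b \<in> {A \<times> B | A B. A \<in> sets M \<and> B \<in> sets N}"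
  then obtain A B A' B' where ab: "a = A \<times> B" "b = A' \<times> B'" "A \<in> sets M" "B \<in> sets N" "A' \<in> sets M" "B' \<in> sets N"
    by blast
  have "a \<inter> b = (A \<inter> A') \<times> (B \<inter> B')" using ab by auto
  then show "a \<inter> b \<in> {A \<times> B | A B. A \<in> sets M \<and> B \<in> sets N}" using ab by blast
  define C where "C = {(A - A') \<times> B, (A \<inter> A') \<times> (B - B')}"
  have "C \<subseteq> {A \<times> B | A B. A \<in> sets M \<and> B \<in> sets N}"
    using ab unfolding C_def by blast
  moreover have "finite C" "disjoint C" "a - b = \<Union>C"
    using ab by (auto simp: C_def disjoint_def)
  ultimately show "\<exists>C\<subseteq>{A \<times> B | A B. A \<in> sets M \<and> B \<in> sets N}. finite C \<and> disjoint C \<and> a - b = \<Union>C"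
    by blast
qed

text \<open>The densities U - m and U - q on K x L are compared rather than m and q: the second is
  nonnegative almost everywhere by the upper bound, while q has no lower bound. The inequality
  extends from rectangles to the set where q > m; there U - q is strictly smaller than U - m, so the
  set is null.\<close>

lemma AE_le_if_le_on_rectangles:
  fixes q :: "'a \<times> 'b \<Rightarrow> real"
  assumes "sigma_finite_measure M" "sigma_finite_measure N"
    and q [measurable]: "q \<in> borel_measurable (M \<Otimes>\<^sub>M N)"
    and K [measurable]: "K \<in> sets M" "L \<in> sets N"
    and fin: "(\<integral>\<^sup>+z. ennreal (U - q z) * indicator (K \<times> L) z \<partial>(M \<Otimes>\<^sub>M N)) < \<infinity>"
    and upper: "AE z in M \<Otimes>\<^sub>M N. q z \<le> U"
    and rect: "\<And>A B. A \<in> sets M \<Longrightarrow> B \<in> sets N \<Longrightarrow> A \<subseteq> K \<Longrightarrow> B \<subseteq> L \<Longrightarrow>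
      ennreal (U - m) * (emeasure M A * emeasure N B)
      \<le> (\<integral>\<^sup>+z. ennreal (U - q z) * indicator (A \<times> B) z \<partial>(M \<Otimes>\<^sub>M N))"
  shows "AE z in M \<Otimes>\<^sub>M N. z \<in> K \<times> L \<longrightarrow> q z \<le> m"
proof (cases "U \<le> m")
  case True
  then show ?thesis using upper by (auto elim!: eventually_mono)
next
  case False
  interpret N: sigma_finite_measure N by fact
  let ?MN = "M \<Otimes>\<^sub>M N"
  let ?S = "{A \<times> B | A B. A \<in> sets M \<and> B \<in> sets N}"
  let ?\<Omega> = "space M \<times> space N"
  define \<nu>1 where "\<nu>1 = density ?MN (\<lambda>z. ennreal (U - m) * indicator (K \<times> L) z)"
  define \<nu>2 where "\<nu>2 = density ?MN (\<lambda>z. ennreal (U - q z) * indicator (K \<times> L) z)"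
  have e1: "emeasure \<nu>1 D = (\<integral>\<^sup>+z. ennreal (U - m) * indicator (K \<times> L) z * indicator D z \<partial>?MN)"
    if "D \<in> sets ?MN" for D
    unfolding \<nu>1_def using that by (intro emeasure_density) auto
  have e2: "emeasure \<nu>2 D = (\<integral>\<^sup>+z. ennreal (U - q z) * indicator (K \<times> L) z * indicator D z \<partial>?MN)"
    if "D \<in> sets ?MN" for D
    unfolding \<nu>2_def using that by (intro emeasure_density) auto
  have le: "emeasure \<nu>1 D \<le> emeasure \<nu>2 D" if D: "D \<in> sets ?MN" for D
  proof (rule emeasure_le_if_le_on_semiring[OF semiring_of_rectangles[of M N]])
    show "?\<Omega> \<in> ?S" by blast
    show "sets \<nu>1 = sigma_sets ?\<Omega> ?S" "sets \<nu>2 = sigma_sets ?\<Omega> ?S"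
      by (simp_all add: \<nu>1_def \<nu>2_def sets_pair_measure)
    show "D \<in> sets \<nu>1" using D by (simp add: \<nu>1_def)
    have "emeasure \<nu>2 ?\<Omega> \<le> (\<integral>\<^sup>+z. ennreal (U - q z) * indicator (K \<times> L) z \<partial>?MN)"
      by (subst e2) (auto intro!: nn_integral_mono simp: indicator_def)
    then show "emeasure \<nu>2 ?\<Omega> < \<infinity>" using fin by (rule order.strict_trans1)
    fix R assume "R \<in> ?S"
    then obtain A B where R: "R = A \<times> B" and [measurable]: "A \<in> sets M" "B \<in> sets N" by blast
    have int: "indicator (K \<times> L) z * indicator R z = (indicator ((A \<inter> K) \<times> (B \<inter> L)) z :: ennreal)" for z
      by (auto simp: R indicator_def)
    have "emeasure \<nu>1 R = (\<integral>\<^sup>+z. ennreal (U - m) * indicator ((A \<inter> K) \<times> (B \<inter> L)) z \<partial>?MN)"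
      by (subst e1) (simp_all add: R[symmetric] mult.assoc int, simp add: R)
    also have "\<dots> = ennreal (U - m) * (emeasure M (A \<inter> K) * emeasure N (B \<inter> L))"
      by (subst nn_integral_cmult_indicator) (simp_all add: N.emeasure_pair_measure_Times)
    also have "\<dots> \<le> (\<integral>\<^sup>+z. ennreal (U - q z) * indicator ((A \<inter> K) \<times> (B \<inter> L)) z \<partial>?MN)"
      by (intro rect) auto
    also have "\<dots> = emeasure \<nu>2 R"
      by (subst e2) (simp_all add: R[symmetric] mult.assoc int, simp add: R)
    finally show "emeasure \<nu>1 R \<le> emeasure \<nu>2 R" .
  qed
  define D where "D = {z \<in> space ?MN. z \<in> K \<times> L \<and> m < q z}"
  have D [measurable]: "D \<in> sets ?MN" unfolding D_def by measurable
  define F where "F z = max 0 (U - q z) * indicator D z" for z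
  define G where "G z = (U - m) * indicator D z" for z
  have [measurable]: "F \<in> borel_measurable ?MN" "G \<in> borel_measurable ?MN"
    unfolding F_def[abs_def] G_def[abs_def] by measurable
  have F0: "0 \<le> F z" "0 \<le> G z" "F z \<le> G z" for z
    using False by (auto simp: F_def G_def D_def indicator_def)
  have nF: "(\<integral>\<^sup>+z. ennreal (F z) \<partial>?MN) = emeasure \<nu>2 D"
    unfolding e2[OF D] by (intro nn_integral_cong) (auto simp: F_def D_def indicator_def max_def ennreal_neg)
  have nG: "(\<integral>\<^sup>+z. ennreal (G z) \<partial>?MN) = emeasure \<nu>1 D"
    unfolding e1[OF D] by (intro nn_integral_cong) (auto simp: G_def D_def indicator_def)
  have "emeasure \<nu>2 D \<le> (\<integral>\<^sup>+z. ennreal (U - q z) * indicator (K \<times> L) z \<partial>?MN)"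
    unfolding e2[OF D] by (intro nn_integral_mono) (auto simp: indicator_def)
  then have finD: "emeasure \<nu>2 D < \<infinity>" using fin by (rule order.strict_trans1)
  have int: "integrable ?MN F" "integrable ?MN G"
    using finD le[OF D] F0 by (auto intro!: integrableI_nonneg simp: nF nG order.strict_trans1)
  have "ennreal (\<integral>z. G z \<partial>?MN) \<le> ennreal (\<integral>z. F z \<partial>?MN)"
    using le[OF D] int F0 by (simp add: nn_integral_eq_integral[symmetric] nF nG)
  then have "(\<integral>z. G z \<partial>?MN) \<le> (\<integral>z. F z \<partial>?MN)"
    using F0 by (simp add: integral_nonneg_AE)
  moreover have "(\<integral>z. F z \<partial>?MN) \<le> (\<integral>z. G z \<partial>?MN)"
    using int F0 by (intro integral_mono) auto
  ultimately have "AE z in ?MN. F z = G z"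
    using int F0 by (intro integral_ineq_eq_0_then_AE) auto
  then show ?thesis
    using AE_space
  proof eventually_elim
    case (elim z)
    show ?case
    proof (rule ccontr)
      assume "\<not> (z \<in> K \<times> L \<longrightarrow> q z \<le> m)"
      then have "z \<in> D" "m < q z" using elim(2) by (auto simp: D_def)
      then show False using elim(1) False by (auto simp: F_def G_def)
    qed
  qed
qed

section \<open>Off-diagonal bounds\<close>

context jump_heat_semigroup
begin

lemma sigma_finite_\<mu>: "sigma_finite_measure \<mu>"
proof -
  obtain u v where uv: "\<And>x::'a. x \<in> u x \<and> u x \<subseteq> v x \<and> open (u x) \<and> compact (v x)"
    using locally_compactE[OF locally_compact] by (metis UNIV_I open_openin subtopology_UNIV)
  obtain \<F> where \<F>: "\<F> \<subseteq> range u" "countable \<F>" "\<Union>\<F> = \<Union>(range u)"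
    using Lindelof[of "range u"] uv by auto
  have "\<Union>(range u) = UNIV" using uv by blast
  moreover have "emeasure \<mu> U \<noteq> \<infinity> \<and> U \<in> sets \<mu>" if U: "U \<in> \<F>" for U
  proof -
    obtain x where x: "U = u x" using U \<F>(1) by blast
    have "compact (v x)" using uv by blast
    then have "emeasure \<mu> (v x) < \<infinity>" "v x \<in> sets \<mu>"
      using radon by (simp_all add: radon_full_support_def borel_compact)
    moreover have "emeasure \<mu> U \<le> emeasure \<mu> (v x)"
      using uv x calculation(2) by (intro emeasure_mono) auto
    ultimately show ?thesis using uv x by (auto simp: top_unique)
  qed
  ultimately show ?thesis
    using \<F> by (intro sigma_finite_measure.intro exI[of _ \<F>]) auto
qed

sublocale sigma_finite_measure \<mu>
  by (rule sigma_finite_\<mu>)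

sublocale \<mu>\<mu>: pair_sigma_finite \<mu> \<mu> ..

text \<open>By symmetry, mass that escapes from \<open>A\<close> to the complement of
  \<open>B\<close> equals mass that enters \<open>A\<close> from there, to which
  \<open>P_entrance_le\<close> applies. The exhaustion by sets of finite measure is needed because
  the indicator of the complement need not be in \<open>L2\<close>.\<close>

lemma nn_integral_P_indicator_outside_le:
  assumes B: "jump_rate B \<Lambda>" and s: "s > 0"
    and A: "A \<in> sets borel" "A \<subseteq> B" "emeasure \<mu> A < \<infinity>"
  shows "(\<integral>\<^sup>+x. ennreal (P s (indicator A) x) * indicator (- B) x \<partial>\<mu>) \<le> ennreal (2 * \<Lambda> * s * measure \<mu> A)"
proof -
  obtain E :: "nat \<Rightarrow> 'a set" where E: "range E \<subseteq> sets \<mu>" "(\<Union>i. E i) = space \<mu>"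
    "\<And>i. emeasure \<mu> (E i) \<noteq> \<infinity>" "incseq E"
    using sigma_finite_incseq by metis
  have [measurable]: "B \<in> sets borel" using jump_rateD(1)[OF B] .
  have E_sets [measurable]: "E n \<in> sets borel" for n using E(1) by auto
  have iA: "indicator A \<in> L2 \<mu>" using A by (intro L2_indicator) auto
  define u where "u = P s (indicator A)"
  have u: "u \<in> L2 \<mu>" unfolding u_def using s iA by (rule P_L2)
  have [measurable]: "u \<in> borel_measurable borel" using L2_measurable[OF u] by simp
  have u0: "AE x in \<mu>. 0 \<le> u x" unfolding u_def using s iA by (rule P_nonneg) simp
  define \<nu> where "\<nu> = density \<mu> (\<lambda>x. ennreal (u x))"
  have e\<nu>: "emeasure \<nu> C = (\<integral>\<^sup>+x. ennreal (u x) * indicator C x \<partial>\<mu>)" if "C \<in> sets borel" for C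
    unfolding \<nu>_def using that by (intro emeasure_density) auto
  have bound: "emeasure \<nu> (E n \<inter> - B) \<le> ennreal (2 * \<Lambda> * s * measure \<mu> A)" for n
  proof -
    let ?g = "indicator (E n \<inter> - B) :: 'a \<Rightarrow> real"
    have "emeasure \<mu> (E n \<inter> - B) \<le> emeasure \<mu> (E n)" by (intro emeasure_mono) auto
    then have g: "?g \<in> L2 \<mu>"
      using E(3)[of n] by (intro L2_indicator) (auto simp: less_top[symmetric] top_unique)
    have "emeasure \<nu> (E n \<inter> - B) = (\<integral>\<^sup>+x. ennreal (u x * ?g x) \<partial>\<mu>)"
      by (subst e\<nu>) (auto intro!: nn_integral_cong simp: indicator_def)
    also have "\<dots> = ennreal (ip u ?g)"
      unfolding l2_inner_def
    proof (rule nn_integral_eq_integral[OF L2_mult_integrable[OF u g]])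
      show "AE x in \<mu>. 0 \<le> u x * ?g x" using u0 by eventually_elim simp
    qed
    also have "ip u ?g = ip (indicator A) (P s ?g)"
      unfolding u_def using s iA g by (rule P_symmetric)
    also have "\<dots> \<le> (\<integral>x. indicator A x * (2 * \<Lambda> * s) \<partial>\<mu>)"
      unfolding l2_inner_def
    proof (rule integral_mono_AE)
      show "integrable \<mu> (\<lambda>x. indicator A x * P s ?g x)"
        using iA P_L2[OF s g] by (rule L2_mult_integrable)
      show "integrable \<mu> (\<lambda>x. indicator A x * (2 * \<Lambda> * s))"
        using A by (intro integrable_mult_left integrable_real_indicator) auto
      have "AE x in \<mu>. x \<in> B \<longrightarrow> P s ?g x \<le> 2 * \<Lambda> * s"
        by (rule P_entrance_le[OF B s g]) (auto simp: indicator_def)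
      then show "AE x in \<mu>. indicator A x * P s ?g x \<le> indicator A x * (2 * \<Lambda> * s)"
        by eventually_elim (use A(2) in \<open>auto simp: indicator_def\<close>)
    qed
    also have "\<dots> = 2 * \<Lambda> * s * measure \<mu> A" using A by (simp add: mult.commute)
    finally show ?thesis by (simp add: ennreal_leI)
  qed
  have "emeasure \<nu> (- B) = (SUP n. emeasure \<nu> (E n \<inter> - B))"
  proof -
    have "range (\<lambda>n. E n \<inter> - B) \<subseteq> sets \<nu>" by (auto simp: \<nu>_def)
    moreover have "incseq (\<lambda>n. E n \<inter> - B)" using E(4) by (auto simp: incseq_def)
    moreover have "(\<Union>n. E n \<inter> - B) = - B" using E(2) by auto
    ultimately show ?thesis using SUP_emeasure_incseq[of "\<lambda>n. E n \<inter> - B" \<nu>] by simp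
  qed
  also have "\<dots> \<le> ennreal (2 * \<Lambda> * s * measure \<mu> A)" by (intro SUP_least bound)
  finally show ?thesis by (simp add: e\<nu> u_def)
qed

lemma P_indicator_le:
  assumes A: "A \<in> sets borel" "emeasure \<mu> A < \<infinity>"
    and rep: "AE x in \<mu>. integrable \<mu> (\<lambda>y. k x y * indicator A y) \<and>
      P s (indicator A) x = (\<integral>y. k x y * indicator A y \<partial>\<mu>)"
    and V: "AE z in \<mu> \<Otimes>\<^sub>M \<mu>. k (fst z) (snd z) \<le> V"
  shows "AE x in \<mu>. P s (indicator A) x \<le> V * measure \<mu> A"
proof -
  have "AE x in \<mu>. AE y in \<mu>. k (fst (x, y)) (snd (x, y)) \<le> V"
    by (rule \<mu>\<mu>.AE_pair[OF V])
  then show ?thesis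
    using rep
  proof eventually_elim
    case (elim x)
    then have "P s (indicator A) x = (\<integral>y. k x y * indicator A y \<partial>\<mu>)" by simp
    also have "\<dots> \<le> (\<integral>y. V * indicator A y \<partial>\<mu>)"
    proof (rule integral_mono_AE)
      show "integrable \<mu> (\<lambda>y. V * indicator A y)" using A by simp
      show "AE y in \<mu>. k x y * indicator A y \<le> V * indicator A y"
        using elim(1) by eventually_elim (auto simp: indicator_def)
    qed (use elim in simp)
    also have "\<dots> = V * measure \<mu> A" using A by simp
    finally show ?case .
  qed
qed

text \<open>Every point lies outside one of the disjoint sets \<open>B\<close> and \<open>B'\<close>. On the complement of each,
  one factor of \<open>P (t/2) 1\<^sub>A \<cdot> P (t/2) 1\<^sub>A\<^sub>'\<close> is small in \<open>L\<^sup>1\<close> and the other is bounded.\<close>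

lemma ip_P_indicators_le:
  assumes t: "t > 0"
    and B: "jump_rate B \<Lambda>" "jump_rate B' \<Lambda>" "B \<inter> B' = {}"
    and A: "A \<in> sets borel" "A \<subseteq> B" "emeasure \<mu> A < \<infinity>"
    and A': "A' \<in> sets borel" "A' \<subseteq> B'" "emeasure \<mu> A' < \<infinity>"
    and V: "0 \<le> V" "AE x in \<mu>. P (t / 2) (indicator A) x \<le> V * measure \<mu> A"
      "AE x in \<mu>. P (t / 2) (indicator A') x \<le> V * measure \<mu> A'"
  shows "ip (P t (indicator A)) (indicator A') \<le> 2 * \<Lambda> * t * V * (measure \<mu> A * measure \<mu> A')"
proof -
  define u u' where "u = P (t / 2) (indicator A)" and "u' = P (t / 2) (indicator A')"
  have i: "indicator A \<in> L2 \<mu>" "indicator A' \<in> L2 \<mu>" using A A' by (auto intro: L2_indicator)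
  have h: "t / 2 > 0" using t by simp
  have u: "u \<in> L2 \<mu>" "u' \<in> L2 \<mu>" unfolding u_def u'_def using h i by (auto intro: P_L2)
  have [measurable]: "u \<in> borel_measurable borel" "u' \<in> borel_measurable borel"
    using u[THEN L2_measurable] by simp_all
  have [measurable]: "B \<in> sets borel" "B' \<in> sets borel" using B jump_rateD(1) by auto
  have nonneg: "AE x in \<mu>. 0 \<le> u x" "AE x in \<mu>. 0 \<le> u' x"
    unfolding u_def u'_def using h i by (auto intro!: P_nonneg)
  have \<Lambda>: "0 \<le> \<Lambda>" using jump_rateD(2)[OF B(1)] .
  define m m' where "m = measure \<mu> A" and "m' = measure \<mu> A'"
  have m: "0 \<le> m" "0 \<le> m'" by (simp_all add: m_def m'_def)
  have "ennreal (ip u u') = (\<integral>\<^sup>+x. ennreal (u x * u' x) \<partial>\<mu>)"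
    unfolding l2_inner_def
  proof (rule nn_integral_eq_integral[symmetric, OF L2_mult_integrable[OF u]])
    show "AE x in \<mu>. 0 \<le> u x * u' x" using nonneg by eventually_elim simp
  qed
  also have "\<dots> \<le> (\<integral>\<^sup>+x. ennreal (V * m') * (ennreal (u x) * indicator (- B) x)
      + ennreal (V * m) * (ennreal (u' x) * indicator (- B') x) \<partial>\<mu>)"
  proof (rule nn_integral_mono_AE)
    show "AE x in \<mu>. ennreal (u x * u' x) \<le> ennreal (V * m') * (ennreal (u x) * indicator (- B) x)
        + ennreal (V * m) * (ennreal (u' x) * indicator (- B') x)"
      using nonneg V(2,3) unfolding u_def[symmetric] u'_def[symmetric] m_def[symmetric] m'_def[symmetric]
    proof eventually_elim
      case (elim x)
      have 1: "ennreal (u x * u' x) \<le> ennreal (V * m') * ennreal (u x)"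
        using elim V(1) m mult_left_mono[of "u' x" "V * m'" "u x"]
        by (simp add: ennreal_mult[symmetric] ennreal_leI mult.commute)
      have 2: "ennreal (u x * u' x) \<le> ennreal (V * m) * ennreal (u' x)"
        using elim V(1) m by (simp add: ennreal_mult[symmetric] ennreal_leI mult_right_mono)
      show ?case
      proof (cases "x \<in> B")
        case True
        then have "x \<notin> B'" using B(3) by auto
        then show ?thesis using True 2 by simp
      next
        case False
        then show ?thesis using 1 by (auto intro!: add_increasing2)
      qed
    qed
  qed
  also have "\<dots> = ennreal (V * m') * (\<integral>\<^sup>+x. ennreal (u x) * indicator (- B) x \<partial>\<mu>)
      + ennreal (V * m) * (\<integral>\<^sup>+x. ennreal (u' x) * indicator (- B') x \<partial>\<mu>)"
    by (subst nn_integral_add) (simp_all add: nn_integral_cmult)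
  \<comment> \<open>Each factor runs for time t / 2 and contributes \<Lambda> t; the two add up to 2
    \<Lambda> t.\<close>
  also have "\<dots> \<le> ennreal (V * m') * ennreal (2 * \<Lambda> * (t / 2) * m) + ennreal (V * m) * ennreal (2 * \<Lambda> * (t / 2) * m')"
    unfolding u_def u'_def m_def m'_def
    using nn_integral_P_indicator_outside_le[OF B(1) h A] nn_integral_P_indicator_outside_le[OF B(2) h A']
    by (intro add_mono mult_left_mono) auto
  also have "\<dots> = ennreal (2 * \<Lambda> * t * V * (m * m'))"
    using V(1) m \<Lambda> t by (simp add: ennreal_mult[symmetric] ennreal_plus[symmetric] algebra_simps del: ennreal_plus)
  finally have "ip u u' \<le> 2 * \<Lambda> * t * V * (m * m')"
    using V(1) m \<Lambda> t by (subst (asm) ennreal_le_iff) auto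
  moreover have "ip u u' = ip (P t (indicator A)) (indicator A')"
    unfolding u_def u'_def using h i by (simp add: ip_P_P)
  ultimately show ?thesis by (simp add: m_def m'_def)
qed

text \<open>A heat kernel is integrable against \<open>L2\<close> functions in its second variable
  only, so joint integrability is not at hand. Since U - p is nonnegative almost everywhere,
  Tonelli's theorem applies to it and expresses its integral over a rectangle through the
  semigroup.\<close>

lemma kernel_off_diagonal_bound:
  fixes p :: "real \<Rightarrow> 'a \<Rightarrow> 'a \<Rightarrow> real"
  assumes t: "t > 0"
    and meas: "(\<lambda>z. p t (fst z) (snd z)) \<in> borel_measurable (\<mu> \<Otimes>\<^sub>M \<mu>)"
    and rep: "\<And>s f. s > 0 \<Longrightarrow> f \<in> L2 \<mu> \<Longrightarrow> AE x in \<mu>. integrable \<mu> (\<lambda>y. p s x y * f y) \<and>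
      P s f x = (\<integral>y. p s x y * f y \<partial>\<mu>)"
    and U: "AE z in \<mu> \<Otimes>\<^sub>M \<mu>. p t (fst z) (snd z) \<le> U"
    and V: "0 \<le> V" "AE z in \<mu> \<Otimes>\<^sub>M \<mu>. p (t / 2) (fst z) (snd z) \<le> V"
    and B: "jump_rate B \<Lambda>" "jump_rate B' \<Lambda>" "B \<inter> B' = {}"
    and K: "K \<in> sets borel" "K \<subseteq> B" "emeasure \<mu> K < \<infinity>"
    and K': "K' \<in> sets borel" "K' \<subseteq> B'" "emeasure \<mu> K' < \<infinity>"
  shows "AE z in \<mu> \<Otimes>\<^sub>M \<mu>. z \<in> K \<times> K' \<longrightarrow> p t (fst z) (snd z) \<le> 2 * \<Lambda> * t * V"
proof -
  note [measurable] = meas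
  have h: "t / 2 > 0" using t by simp
  have key: "(\<integral>\<^sup>+z. ennreal (U - p t (fst z) (snd z)) * indicator (A \<times> A') z \<partial>(\<mu> \<Otimes>\<^sub>M \<mu>))
      = ennreal (U * (measure \<mu> A * measure \<mu> A') - ip (P t (indicator A')) (indicator A))"
    if A [measurable]: "A \<in> sets borel" and Af: "emeasure \<mu> A < \<infinity>"
      and A' [measurable]: "A' \<in> sets borel" and Af': "emeasure \<mu> A' < \<infinity>" for A A'
  proof -
    have i: "indicator A \<in> L2 \<mu>" "indicator A' \<in> L2 \<mu>"
      using A A' Af Af' by (auto intro: L2_indicator)
    have i': "integrable \<mu> (\<lambda>x. indicator A x * P t (indicator A') x)"
      using i P_L2[OF t i(2)] by (intro L2_mult_integrable)
    have "(\<integral>\<^sup>+z. ennreal (U - p t (fst z) (snd z)) * indicator (A \<times> A') z \<partial>(\<mu> \<Otimes>\<^sub>M \<mu>))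
      = (\<integral>\<^sup>+x. \<integral>\<^sup>+y. ennreal (U - p t x y) * indicator (A \<times> A') (x, y) \<partial>\<mu> \<partial>\<mu>)"
      by (subst nn_integral_fst[symmetric]) simp_all
    also have "\<dots> = (\<integral>\<^sup>+x. ennreal (indicator A x * (U * measure \<mu> A' - P t (indicator A') x)) \<partial>\<mu>)"
    proof (rule nn_integral_cong_AE)
      have "AE x in \<mu>. AE y in \<mu>. p t (fst (x, y)) (snd (x, y)) \<le> U" by (rule \<mu>\<mu>.AE_pair[OF U])
      then show "AE x in \<mu>. (\<integral>\<^sup>+y. ennreal (U - p t x y) * indicator (A \<times> A') (x, y) \<partial>\<mu>)
          = ennreal (indicator A x * (U * measure \<mu> A' - P t (indicator A') x))"
        using rep[OF t i(2)]
      proof eventually_elim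
        case (elim x)
        have int: "integrable \<mu> (\<lambda>y. U * indicator A' y - p t x y * indicator A' y)"
          using elim(2) Af' A' by (intro Bochner_Integration.integrable_diff) auto
        have "(\<integral>\<^sup>+y. ennreal (U - p t x y) * indicator (A \<times> A') (x, y) \<partial>\<mu>)
            = (\<integral>\<^sup>+y. ennreal (U * indicator A' y - p t x y * indicator A' y) * indicator A x \<partial>\<mu>)"
          by (intro nn_integral_cong) (auto simp: indicator_def)
        also have "\<dots> = (\<integral>\<^sup>+y. ennreal (U * indicator A' y - p t x y * indicator A' y) \<partial>\<mu>) * indicator A x"
          using int by (intro nn_integral_multc) auto
        also have "(\<integral>\<^sup>+y. ennreal (U * indicator A' y - p t x y * indicator A' y) \<partial>\<mu>)
            = ennreal (\<integral>y. U * indicator A' y - p t x y * indicator A' y \<partial>\<mu>)"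
        proof (rule nn_integral_eq_integral[OF int])
          show "AE y in \<mu>. 0 \<le> U * indicator A' y - p t x y * indicator A' y"
            using elim(1) by eventually_elim (auto simp: indicator_def)
        qed
        also have "(\<integral>y. U * indicator A' y - p t x y * indicator A' y \<partial>\<mu>)
            = U * measure \<mu> A' - P t (indicator A') x"
          using elim(2) Af' A' by (subst Bochner_Integration.integral_diff) auto
        finally show ?case by (auto simp: indicator_def)
      qed
    qed
    also have "\<dots> = ennreal (\<integral>x. indicator A x * (U * measure \<mu> A' - P t (indicator A') x) \<partial>\<mu>)"
    proof (rule nn_integral_eq_integral)
      show "integrable \<mu> (\<lambda>x. indicator A x * (U * measure \<mu> A' - P t (indicator A') x))"
        using i' Af by (simp add: right_diff_distrib)
      have "AE x in \<mu>. P t (indicator A') x \<le> U * measure \<mu> A'"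
        by (rule P_indicator_le[OF A' Af' rep[OF t i(2)] U])
      then show "AE x in \<mu>. 0 \<le> indicator A x * (U * measure \<mu> A' - P t (indicator A') x)"
        by eventually_elim simp
    qed
    also have "(\<integral>x. indicator A x * (U * measure \<mu> A' - P t (indicator A') x) \<partial>\<mu>)
        = U * (measure \<mu> A * measure \<mu> A') - ip (P t (indicator A')) (indicator A)"
      using i' Af by (simp add: right_diff_distrib l2_inner_def mult.commute)
    finally show ?thesis .
  qed
  show ?thesis
  proof (rule AE_le_if_le_on_rectangles[OF sigma_finite_\<mu> sigma_finite_\<mu> meas _ _ _ U])
    show "K \<in> sets \<mu>" "K' \<in> sets \<mu>" using K K' by auto
    show "(\<integral>\<^sup>+z. ennreal (U - p t (fst z) (snd z)) * indicator (K \<times> K') z \<partial>(\<mu> \<Otimes>\<^sub>M \<mu>)) < \<infinity>"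
      using K K' by (simp add: key)
    fix A A'
    assume "A \<in> sets \<mu>" "A' \<in> sets \<mu>" and sub: "A \<subseteq> K" "A' \<subseteq> K'"
    then have A: "A \<in> sets borel" "A' \<in> sets borel" by auto
    have Af: "emeasure \<mu> A < \<infinity>" "emeasure \<mu> A' < \<infinity>"
      using emeasure_mono[OF sub(1), of \<mu>] emeasure_mono[OF sub(2), of \<mu>] K K'
      by (auto simp: order.strict_trans1)
    have i: "indicator A \<in> L2 \<mu>" "indicator A' \<in> L2 \<mu>" using A Af by (auto intro: L2_indicator)
    \<comment> \<open>The semigroup acts on the second variable of the kernel, so the indicator of
      A' is the one evolved, and \<open>B\<close> and \<open>B'\<close> exchange roles.\<close>
    have "ip (P t (indicator A')) (indicator A) \<le> 2 * \<Lambda> * t * V * (measure \<mu> A' * measure \<mu> A)"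
      using B K K' sub A Af V i P_indicator_le[OF _ _ rep[OF h] V(2)]
      by (intro ip_P_indicators_le[OF t B(2,1)]) auto
    then have "(U - 2 * \<Lambda> * t * V) * (measure \<mu> A * measure \<mu> A')
        \<le> U * (measure \<mu> A * measure \<mu> A') - ip (P t (indicator A')) (indicator A)"
      by (simp add: algebra_simps)
    then have "ennreal ((U - 2 * \<Lambda> * t * V) * (measure \<mu> A * measure \<mu> A'))
        \<le> (\<integral>\<^sup>+z. ennreal (U - p t (fst z) (snd z)) * indicator (A \<times> A') z \<partial>(\<mu> \<Otimes>\<^sub>M \<mu>))"
      unfolding key[OF A(1) Af(1) A(2) Af(2)] by (rule ennreal_leI)
    then show "ennreal (U - 2 * \<Lambda> * t * V) * (emeasure \<mu> A * emeasure \<mu> A')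
        \<le> (\<integral>\<^sup>+z. ennreal (U - p t (fst z) (snd z)) * indicator (A \<times> A') z \<partial>(\<mu> \<Otimes>\<^sub>M \<mu>))"
      using Af by (simp add: emeasure_eq_ennreal_measure ennreal_mult'' less_top)
  qed
qed

text \<open>Exceptional null sets must be countable in number. Every ball of radius r has a centre
  in a countable dense set, so countably many pairs of disjoint balls, intersected with sets of
  finite measure, cover all pairs of points further apart than r.\<close>

lemma kernel_bound_at_distance:
  fixes p :: "real \<Rightarrow> 'a \<Rightarrow> 'a \<Rightarrow> real"
  assumes t: "t > 0"
    and meas: "(\<lambda>z. p t (fst z) (snd z)) \<in> borel_measurable (\<mu> \<Otimes>\<^sub>M \<mu>)"
    and rep: "\<And>s f. s > 0 \<Longrightarrow> f \<in> L2 \<mu> \<Longrightarrow> AE x in \<mu>. integrable \<mu> (\<lambda>y. p s x y * f y) \<and>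
      P s f x = (\<integral>y. p s x y * f y \<partial>\<mu>)"
    and U: "AE z in \<mu> \<Otimes>\<^sub>M \<mu>. p t (fst z) (snd z) \<le> U"
    and V: "0 \<le> V" "AE z in \<mu> \<Otimes>\<^sub>M \<mu>. p (t / 2) (fst z) (snd z) \<le> V"
    and r: "r > 0" and \<Lambda>: "0 \<le> \<Lambda>" "\<And>x. emeasure (J x) (- cball x r) \<le> ennreal \<Lambda>"
  shows "AE z in \<mu> \<Otimes>\<^sub>M \<mu>. r < dist (fst z) (snd z) \<longrightarrow> p t (fst z) (snd z) \<le> 2 * \<Lambda> * t * V"
proof -
  obtain E :: "nat \<Rightarrow> 'a set" where E: "range E \<subseteq> sets \<mu>" "(\<Union>i. E i) = space \<mu>"
    "\<And>i. emeasure \<mu> (E i) \<noteq> \<infinity>" "incseq E"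
    using sigma_finite_incseq by metis
  obtain D :: "'a set" where D: "countable D" "\<And>X. open X \<Longrightarrow> X \<noteq> {} \<Longrightarrow> \<exists>d\<in>D. d \<in> X"
    by (rule countable_dense_setE) blast
  have "AE z in \<mu> \<Otimes>\<^sub>M \<mu>. cball d r \<inter> cball d' r = {} \<longrightarrow>
      z \<in> (E n \<inter> cball d r) \<times> (E n \<inter> cball d' r) \<longrightarrow> p t (fst z) (snd z) \<le> 2 * \<Lambda> * t * V" for n d d'
  proof (cases "cball d r \<inter> cball d' r = {}")
    case True
    have fin: "emeasure \<mu> (E n \<inter> cball x r) < \<infinity>" for x
    proof -
      have "emeasure \<mu> (E n \<inter> cball x r) \<le> emeasure \<mu> (E n)"
        using E(1) by (intro emeasure_mono) auto
      also have "\<dots> < \<infinity>" using E(3)[of n] by (simp add: less_top)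
      finally show ?thesis .
    qed
    have "E n \<inter> cball x r \<in> sets borel" for x using E(1) by auto
    then have "AE z in \<mu> \<Otimes>\<^sub>M \<mu>. z \<in> (E n \<inter> cball d r) \<times> (E n \<inter> cball d' r) \<longrightarrow>
        p t (fst z) (snd z) \<le> 2 * \<Lambda> * t * V"
      using fin True
      by (intro kernel_off_diagonal_bound[OF t meas rep U V jump_rate_ball[OF r \<Lambda>] jump_rate_ball[OF r \<Lambda>]])
        auto
    then show ?thesis by eventually_elim blast
  qed simp
  then have "AE z in \<mu> \<Otimes>\<^sub>M \<mu>. \<forall>n. \<forall>d\<in>D. \<forall>d'\<in>D. cball d r \<inter> cball d' r = {} \<longrightarrow>
      z \<in> (E n \<inter> cball d r) \<times> (E n \<inter> cball d' r) \<longrightarrow> p t (fst z) (snd z) \<le> 2 * \<Lambda> * t * V"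
    using D(1) by (simp only: AE_all_countable AE_ball_countable) blast
  then show ?thesis
  proof eventually_elim
    case (elim z)
    show ?case
    proof
      assume far: "r < dist (fst z) (snd z)"
      have "\<exists>d\<in>D. x \<in> cball d r" for x
        using D(2)[OF cball_open[OF r, of x]] r by (auto simp: dist_commute)
      then obtain d d' where d: "d \<in> D" "d' \<in> D" "fst z \<in> cball d r" "snd z \<in> cball d' r" by blast
      have "cball d r \<inter> cball d' r = {}"
      proof (rule ccontr)
        assume "cball d r \<inter> cball d' r \<noteq> {}"
        then obtain w where "w \<in> cball d r" "w \<in> cball d' r" by blast
        then have "cball d r = cball d' r" using cball_eq[of w d r] cball_eq[of w d' r] by simp
        then have "snd z \<in> cball (fst z) r" using d cball_eq[of "fst z" d r] by simp
        with far show False by simp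
      qed
      moreover obtain n where "fst z \<in> E n" "snd z \<in> E n"
      proof -
        obtain n1 n2 where "fst z \<in> E n1" "snd z \<in> E n2" using E(2) by (metis UNIV_I UN_E space_\<mu>)
        then show ?thesis
          using that[of "max n1 n2"] incseqD[OF E(4), of n1 "max n1 n2"] incseqD[OF E(4), of n2 "max n1 n2"]
          by auto
      qed
      then have "z \<in> (E n \<inter> cball d r) \<times> (E n \<inter> cball d' r)" using d by (auto simp: mem_Times_iff)
      ultimately show "p t (fst z) (snd z) \<le> 2 * \<Lambda> * t * V" using elim d by blast
    qed
  qed
qed

end

section \<open>Choice of radii and constants\<close>

theorem theorem1:
  fixes \<mu> :: "'a::{metric_space, second_countable_topology} measure"
    and j :: "('a \<times> 'a) measure"
    and \<alpha> \<beta> :: real and R0 :: ereal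
  assumes "ultrametric_space TYPE('a)"
    and "radon_full_support \<mu>"
    and "jump_measure j"
    and "0 < \<alpha>" and "0 < \<beta>"
    and "0 < R0" and "R0 \<le> diam_M TYPE('a)"
    and "cond_TJ \<mu> j \<beta> R0"
    and "cond_DUE \<mu> j \<alpha> \<beta> R0"
  shows "cond_wUE \<mu> j \<alpha> \<beta> R0"
proof -
  obtain J CJ where J: "jump_kernel \<mu> j J"
    and CJ: "\<And>x r. 0 < r \<Longrightarrow> ereal r < R0 \<Longrightarrow> emeasure (J x) (- cball x r) \<le> ennreal (CJ * r powr (- \<beta>))"
    using \<open>cond_TJ \<mu> j \<beta> R0\<close> unfolding cond_TJ_def by auto
  obtain p C1 where p: "heat_kernel \<mu> j p" and C1: "C1 > 0"
    and due: "\<And>t. 0 < t \<Longrightarrow> ereal t < ereal_powr R0 \<beta> \<Longrightarrow>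
      AE z in \<mu> \<Otimes>\<^sub>M \<mu>. p t (fst z) (snd z) \<le> C1 * t powr (- \<alpha> / \<beta>)"
    using \<open>cond_DUE \<mu> j \<alpha> \<beta> R0\<close> unfolding cond_DUE_def by auto
  obtain P where P: "heat_semigroup \<mu> j P"
    and pP: "\<forall>t>0. (\<lambda>z. p t (fst z) (snd z)) \<in> borel_measurable (\<mu> \<Otimes>\<^sub>M \<mu>) \<and>
      (\<forall>f\<in>L2 \<mu>. AE x in \<mu>. integrable \<mu> (\<lambda>y. p t x y * f y) \<and> P t f x = (\<integral>y. p t x y * f y \<partial>\<mu>))"
    using p unfolding heat_kernel_def by (elim exE conjE)
  interpret jump_heat_semigroup \<mu> j P J
    using assms(1) unfolding ultrametric_space_def
    by unfold_locales (use P J assms(2,3) in blast)+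
  \<comment> \<open>The sign of the constant in (TJ) is not prescribed, whereas a jump rate must be
    nonnegative.\<close>
  define C0 where "C0 = max CJ 0"
  have C0: "0 \<le> C0" by (simp add: C0_def)
  \<comment> \<open>The outer power of 2 covers distances up to t^(1/\<beta>). In the second summand
    2^(\<alpha>/\<beta>) comes from (DUE) at time t / 2; two factors 2^\<beta> in all come from
    rounding the radius to a power of 2 and from 1 + \<rho>/\<tau> \<le> 2 \<rho>/\<tau>.\<close>
  define C where "C = C1 * 2 powr \<beta> * (1 + 2 * C0 * 2 powr (\<alpha> / \<beta>) * 2 powr \<beta>)"
  have "C > 0" unfolding C_def using C1 C0 by (intro mult_pos_pos add_pos_nonneg) auto
  have "AE z in \<mu> \<Otimes>\<^sub>M \<mu>. p t (fst z) (snd z) \<le>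
      C / t powr (\<alpha> / \<beta>) * (1 + dist_min R0 (fst z) (snd z) / t powr (1 / \<beta>)) powr (- \<beta>)"
    if t: "0 < t" "ereal t < ereal_powr R0 \<beta>" for t
  proof -
    define U where "U = C1 * t powr (- \<alpha> / \<beta>)"
    define V where "V = C1 * (t / 2) powr (- \<alpha> / \<beta>)"
    define \<tau> where "\<tau> = t powr (1 / \<beta>)"
    have U0: "0 < U" and \<tau>: "0 < \<tau>" using C1 t by (simp_all add: U_def \<tau>_def)
    have V: "V = 2 powr (\<alpha> / \<beta>) * U"
      using t by (simp add: V_def U_def powr_divide powr_minus field_simps)
    have \<tau>\<beta>: "\<tau> powr \<beta> = t" using t \<open>0 < \<beta>\<close> by (simp add: \<tau>_def powr_powr)
    have due_U: "AE z in \<mu> \<Otimes>\<^sub>M \<mu>. p t (fst z) (snd z) \<le> U"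
      unfolding U_def by (rule due[OF t])
    have due_V: "AE z in \<mu> \<Otimes>\<^sub>M \<mu>. p (t / 2) (fst z) (snd z) \<le> V"
      unfolding V_def
    proof (rule due)
      have "ereal (t / 2) < ereal t" using t by simp
      then show "ereal (t / 2) < ereal_powr R0 \<beta>" using t(2) by (rule less_trans)
    qed (use t in simp)
    \<comment> \<open>The suitable radius depends on the pair of points; restricting it to powers of
      2 leaves countably many null sets.\<close>
    have far: "AE z in \<mu> \<Otimes>\<^sub>M \<mu>. ereal (2 powr real_of_int k) < R0 \<longrightarrow>
        2 powr real_of_int k < dist (fst z) (snd z) \<longrightarrow>
        p t (fst z) (snd z) \<le> 2 * (C0 * (2 powr real_of_int k) powr (- \<beta>)) * t * V" for k :: int
    proof (cases "ereal (2 powr real_of_int k) < R0")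
      case True
      have "emeasure (J x) (- cball x (2 powr real_of_int k))
          \<le> ennreal (C0 * (2 powr real_of_int k) powr (- \<beta>))" for x
      proof -
        have "emeasure (J x) (- cball x (2 powr real_of_int k))
            \<le> ennreal (CJ * (2 powr real_of_int k) powr (- \<beta>))"
          using True by (intro CJ) auto
        also have "\<dots> \<le> ennreal (C0 * (2 powr real_of_int k) powr (- \<beta>))"
          by (intro ennreal_leI mult_right_mono) (auto simp: C0_def)
        finally show ?thesis .
      qed
      then have "AE z in \<mu> \<Otimes>\<^sub>M \<mu>. 2 powr real_of_int k < dist (fst z) (snd z) \<longrightarrow>
          p t (fst z) (snd z) \<le> 2 * (C0 * (2 powr real_of_int k) powr (- \<beta>)) * t * V"
        using t pP due_U due_V C0 U0 V
        by (intro kernel_bound_at_distance[of t p U V]) auto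
      then show ?thesis by eventually_elim simp
    qed simp
    have "AE z in \<mu> \<Otimes>\<^sub>M \<mu>. \<forall>k::int. ereal (2 powr real_of_int k) < R0 \<longrightarrow>
        2 powr real_of_int k < dist (fst z) (snd z) \<longrightarrow>
        p t (fst z) (snd z) \<le> 2 * (C0 * (2 powr real_of_int k) powr (- \<beta>)) * t * V"
      unfolding AE_all_countable by (intro allI far)
    with due_U show ?thesis
    proof eventually_elim
      case (elim z)
      define d where "d = dist (fst z) (snd z)"
      define \<rho> where "\<rho> = dist_min R0 (fst z) (snd z)"
      have \<rho>: "0 \<le> \<rho>" "\<rho> \<le> d" "ereal \<rho> \<le> R0"
        using \<open>0 < R0\<close> unfolding \<rho>_def d_def dist_min_def
        by (cases R0; auto simp: min_def)+
      have Ut: "C / t powr (\<alpha> / \<beta>) = U * (2 powr \<beta> * (1 + 2 * C0 * 2 powr (\<alpha> / \<beta>) * 2 powr \<beta>))"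
        by (simp add: C_def U_def powr_minus field_simps)
      define \<kappa> where "\<kappa> = 1 + \<rho> / \<tau>"
      have \<kappa>: "0 < \<kappa>" unfolding \<kappa>_def using \<rho>(1) \<tau> by (intro add_pos_nonneg) auto
      have "p t (fst z) (snd z) \<le> U * (2 powr \<beta> * (1 + 2 * C0 * 2 powr (\<alpha> / \<beta>) * 2 powr \<beta>))
          * \<kappa> powr (- \<beta>)"
      proof (cases "\<rho> \<le> \<tau>")
        case True
        then have "\<kappa> \<le> 2" using \<tau> by (simp add: \<kappa>_def)
        then have "\<kappa> powr \<beta> \<le> 2 powr \<beta>"
          using \<kappa> \<open>0 < \<beta>\<close> by (intro powr_mono2) auto
        then have "1 \<le> 2 powr \<beta> * \<kappa> powr (- \<beta>)"
          using \<kappa> by (simp add: powr_minus field_simps)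
        also have "\<dots> = (2 powr \<beta> * \<kappa> powr (- \<beta>)) * 1" by simp
        also have "\<dots> \<le> (2 powr \<beta> * \<kappa> powr (- \<beta>)) * (1 + 2 * C0 * 2 powr (\<alpha> / \<beta>) * 2 powr \<beta>)"
          using C0 by (intro mult_left_mono) auto
        finally have "U * 1 \<le> U * ((2 powr \<beta> * \<kappa> powr (- \<beta>)) * (1 + 2 * C0 * 2 powr (\<alpha> / \<beta>) * 2 powr \<beta>))"
          using U0 by (intro mult_left_mono) auto
        with elim(1) show ?thesis by (simp add: algebra_simps)
      next
        case False
        then have \<rho>0: "0 < \<rho>" "\<tau> < \<rho>" using \<tau> by auto
        \<comment> \<open>The ceiling minus 1 gives r < \<rho> \<le> 2 r with strict inequality even
          if \<rho> is a power of 2. This yields both r < R0 and r < d(x,y).\<close>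
        define k where "k = \<lceil>log 2 \<rho>\<rceil> - 1"
        define r where "r = 2 powr real_of_int k"
        have "real_of_int k < log 2 \<rho>" "log 2 \<rho> \<le> real_of_int k + 1"
          unfolding k_def by linarith+
        then have r: "0 < r" "r < \<rho>" "\<rho> \<le> 2 * r"
          using \<rho>0(1) by (auto simp: r_def less_log_iff log_le_iff powr_add)
        have "ereal r < R0" using r(2) \<rho>(3) by (metis less_ereal.simps(1) order.strict_trans2)
        then have "p t (fst z) (snd z) \<le> 2 * (C0 * r powr (- \<beta>)) * t * V"
          using elim(2) r \<rho>(2) unfolding r_def d_def by force
        also have "\<dots> = U * (2 * C0 * 2 powr (\<alpha> / \<beta>)) * (t * r powr (- \<beta>))" by (simp add: V)
        also have "\<dots> \<le> U * (2 * C0 * 2 powr (\<alpha> / \<beta>)) * (2 powr \<beta> * 2 powr \<beta> * \<kappa> powr (- \<beta>))"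
        proof (rule mult_left_mono)
          have "\<tau> * \<kappa> \<le> 2 * \<rho>" using \<rho>0 \<tau> by (simp add: \<kappa>_def distrib_left)
          also have "\<dots> \<le> 2 * 2 * r" using r by simp
          finally have "(\<tau> * \<kappa>) powr \<beta> \<le> (2 * 2 * r) powr \<beta>"
            using \<kappa> \<tau> \<open>0 < \<beta>\<close> by (intro powr_mono2) auto
          then have "t * \<kappa> powr \<beta> \<le> 2 powr \<beta> * 2 powr \<beta> * r powr \<beta>"
            using \<kappa> \<tau> r powr_mult[of 2 2 \<beta>] by (simp add: powr_mult \<tau>\<beta>)
          then show "t * r powr (- \<beta>) \<le> 2 powr \<beta> * 2 powr \<beta> * \<kappa> powr (- \<beta>)"
            using \<kappa> r(1) by (simp add: powr_minus field_simps)
        qed (use U0 C0 in simp)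
        also have "\<dots> \<le> U * (2 powr \<beta> * (1 + 2 * C0 * 2 powr (\<alpha> / \<beta>) * 2 powr \<beta>)) * \<kappa> powr (- \<beta>)"
          using U0 C0 by (simp add: algebra_simps)
        finally show ?thesis .
      qed
      then show ?case by (simp add: Ut \<kappa>_def \<rho>_def \<tau>_def)
    qed
  qed
  with p \<open>C > 0\<close> show ?thesis unfolding cond_wUE_def by blast
qed

end
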